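(* The number of equivalence classes of $BH(4,n)$ matrices for $n=1,2,4,6,8$ is $1,1,2,1,15$, respectively.
   Context: A complex Hadamard matrix of order $n$ is an $n\times n$ complex matrix $H$ with unimodular entries satisfying $HH^\ast=nI$. A $BH(4,n)$ (quaternary complex Hadamard) matrix is a complex Hadamard matrix of order $n$ all of whose entries are fourth roots of unity. Two complex Hadamard matrices $H,K$ of order $n$ are equivalent if there exist permutation matrices $P_1,P_2$ and unitary diagonal matrices $D_1,D_2$ with $P_1D_1HD_2P_2=K$ (transposition is not part of the equivalence). *)

theory Defs
  imports
    "HOL-Combinatorics.Permutations"
    "Jordan_Normal_Form.Schur_Decomposition"
begin

definition complex_Hadamard :: "nat \<Rightarrow> complex mat set" where
  "complex_Hadamard n = {H \<in> carrier_mat n n.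
     (\<forall>i<n. \<forall>j<n. cmod (H $$ (i, j)) = 1) \<and>
     H * mat_adjoint H = of_nat n \<cdot>\<^sub>m 1\<^sub>m n}"

definition BH :: "nat \<Rightarrow> nat \<Rightarrow> complex mat set" where
  "BH q n = {H \<in> complex_Hadamard n. \<forall>i<n. \<forall>j<n. (H $$ (i, j)) ^ q = 1}"

definition permutation_matrix :: "nat \<Rightarrow> complex mat \<Rightarrow> bool" where
  "permutation_matrix n P \<longleftrightarrow>
     (\<exists>p. p permutes {..<n} \<and> P = mat n n (\<lambda>(i, j). if j = p i then 1 else 0))"

definition unitary_diagonal :: "nat \<Rightarrow> complex mat \<Rightarrow> bool" where
  "unitary_diagonal n D \<longleftrightarrow>
     D \<in> carrier_mat n n \<and> diagonal_mat D \<and> D * mat_adjoint D = 1\<^sub>m n"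

definition Hadamard_equiv :: "nat \<Rightarrow> complex mat rel" where
  "Hadamard_equiv n =
     {(H, K). H \<in> complex_Hadamard n \<and> K \<in> complex_Hadamard n \<and>
        (\<exists>P1 P2 D1 D2. permutation_matrix n P1 \<and> permutation_matrix n P2 \<and>
           unitary_diagonal n D1 \<and> unitary_diagonal n D2 \<and>
           P1 * D1 * H * D2 * P2 = K)}"

definition BH_classes :: "nat \<Rightarrow> nat \<Rightarrow> complex mat set set" where
  "BH_classes q n = BH q n // Restr (Hadamard_equiv n) (BH q n)"

end

(* Write a BH(4,n) matrix as i^E with exponents E in Z/4.  Equivalence then amounts to permuting
   rows and columns of E and adding constants to its rows and columns.

   Upper bound: build the matrices row by row up to equivalence.  A further row of a partial
   matrix R may be taken to start with 0 and to be sorted inside each block of equal columns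
   of R, which leaves a short list of candidates.  For every one of them the certificate (p, q)
   lists the row and column permutations that turn the extended matrix, once normalized to zero
   first row and column, into a listed representative.  For n = 8 there are 3 partial matrices
   with two rows and 8 with three rows; each of the latter is completed at once, by running
   through the 5-cliques of the orthogonality graph on all its candidate rows.

   Lower bound: the representatives are told apart by the number of row triples (u, v, w) with
   sum_j i^(2 u_j - v_j - w_j) = 0, the same number for columns, and the number of pairs (v = w). *)

theory Submission
  imports Defs
begin

section \<open>Exponent matrices\<close>

text \<open>All computations run by \<open>code_simp\<close>, that is by rewriting inside the logic,
  and this shapes the functions: Z/4 is a four-element datatype with tables, the vanishing of a sum
  of fourth roots of unity becomes a comparison of letter counts, and no canonical form of a matrix
  is ever computed. A certificate names one equivalence and is merely checked, so soundness does not
  depend on how it was found. That the lists of candidates miss nothing is a theorem about the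
  enumeration (\<open>candidates_complete\<close>, \<open>cliques_complete\<close>). The induction
  on the number of rows speaks of full Hadamard matrices (\<open>covered_by\<close>): each is
  equivalent to one whose first k rows are listed. Hence the intermediate lists may contain
  equivalent entries, or entries without any completion; inequivalence is required of the final list
  only. The triples (u, v, w) enter through 2u - v - w because these coefficients add up to 0:
  constants added to columns cancel, and constants added to rows turn into a nonzero factor.\<close>

datatype z4 = Z0 | Z1 | Z2 | Z3

text \<open>Full tables on constructors, instead of arithmetic modulo 4, let the simplifier carry
  out each operation in a single rewrite step.\<close>

instantiation z4 :: ab_group_add
begin

definition zero_z4 :: z4 where "0 = Z0"

fun plus_z4 :: "z4 \<Rightarrow> z4 \<Rightarrow> z4" where
  "x + Z0 = x"
| "Z0 + Z1 = Z1" | "Z1 + Z1 = Z2" | "Z2 + Z1 = Z3" | "Z3 + Z1 = Z0"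
| "Z0 + Z2 = Z2" | "Z1 + Z2 = Z3" | "Z2 + Z2 = Z0" | "Z3 + Z2 = Z1"
| "Z0 + Z3 = Z3" | "Z1 + Z3 = Z0" | "Z2 + Z3 = Z1" | "Z3 + Z3 = Z2"

fun uminus_z4 :: "z4 \<Rightarrow> z4" where
  "- Z0 = Z0" | "- Z1 = Z3" | "- Z2 = Z2" | "- Z3 = Z1"

fun minus_z4 :: "z4 \<Rightarrow> z4 \<Rightarrow> z4" where
  "x - Z0 = x"
| "Z0 - Z1 = Z3" | "Z1 - Z1 = Z0" | "Z2 - Z1 = Z1" | "Z3 - Z1 = Z2"
| "Z0 - Z2 = Z2" | "Z1 - Z2 = Z3" | "Z2 - Z2 = Z0" | "Z3 - Z2 = Z1"
| "Z0 - Z3 = Z1" | "Z1 - Z3 = Z2" | "Z2 - Z3 = Z3" | "Z3 - Z3 = Z0"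

instance
proof
  fix a b c :: z4
  show "a + b + c = a + (b + c)" by (cases a; cases b; cases c; simp)
  show "a + b = b + a" by (cases a; cases b; simp)
  show "0 + a = a" by (cases a; simp add: zero_z4_def)
  show "- a + a = 0" by (cases a; simp add: zero_z4_def)
  show "a - b = a + - b" by (cases a; cases b; simp)
qed

end

fun iu :: "z4 \<Rightarrow> complex" where
  "iu Z0 = 1" | "iu Z1 = \<i>" | "iu Z2 = - 1" | "iu Z3 = - \<i>"

lemma iu_0 [simp]: "iu 0 = 1"
  by (simp add: zero_z4_def)

lemma iu_add: "iu (x + y) = iu x * iu y"
  by (cases x; cases y; simp)

lemma iu_diff: "iu (x - y) = iu x * cnj (iu y)"
  by (cases x; cases y; simp)

lemma iu_nonzero [simp]: "iu x \<noteq> 0"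
  by (cases x; simp)

lemma norm_iu [simp]: "cmod (iu x) = 1"
  by (cases x; simp)

lemma iu_mult_cnj [simp]: "iu x * cnj (iu x) = 1"
  by (cases x; simp)

lemma iu_power4 [simp]: "iu x ^ 4 = 1"
  by (cases x; simp)

lemma iu_eq_iff [simp]: "iu x = iu y \<longleftrightarrow> x = y"
  by (cases x; cases y; simp add: complex_eq_iff)

lemma fourth_root_of_unity_iu:
  assumes "z ^ 4 = (1 :: complex)"
  shows "\<exists>x. z = iu x"
proof -
  have "(z - 1) * (z + 1) * (z - \<i>) * (z + \<i>) = z ^ 4 - 1"
    by (simp add: algebra_simps power4_eq_xxxx)
  hence "z = 1 \<or> z = - 1 \<or> z = \<i> \<or> z = - \<i>"
    using assms by (simp add: eq_neg_iff_add_eq_0)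
  thus ?thesis
    by (metis iu.simps)
qed

section \<open>Equivalence in terms of exponents\<close>

definition exp_mat :: "nat \<Rightarrow> (nat \<Rightarrow> nat \<Rightarrow> z4) \<Rightarrow> complex mat" where
  "exp_mat n E = mat n n (\<lambda>(i, j). iu (E i j))"

text \<open>Only off-diagonal inner products of rows appear: with unimodular entries the diagonal of
  H times its adjoint is n automatically.\<close>

definition hadamard :: "nat \<Rightarrow> (nat \<Rightarrow> nat \<Rightarrow> z4) \<Rightarrow> bool" where
  "hadamard n E \<longleftrightarrow> (\<forall>i<n. \<forall>k<n. i \<noteq> k \<longrightarrow> (\<Sum>j<n. iu (E i j - E k j)) = 0)"

text \<open>The constants \<open>r\<close> and \<open>c\<close> lie in Z/4, although
  \<open>Hadamard_equiv\<close> admits arbitrary unitary diagonals;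
  \<open>Hadamard_equiv_exp_mat_iff\<close> shows that nothing is lost.\<close>

definition equivalent :: "nat \<Rightarrow> (nat \<Rightarrow> nat \<Rightarrow> z4) \<Rightarrow> (nat \<Rightarrow> nat \<Rightarrow> z4) \<Rightarrow> bool" where
  "equivalent n E F \<longleftrightarrow> (\<exists>p q r c. p permutes {..<n} \<and> q permutes {..<n} \<and>
     (\<forall>i<n. \<forall>j<n. F i j = E (p i) (q j) + r i + c j))"

lemma equivalentI:
  assumes "p permutes {..<n}" "q permutes {..<n}"
    and "\<And>i j. i < n \<Longrightarrow> j < n \<Longrightarrow> F i j = E (p i) (q j) + r i + c j"
  shows "equivalent n E F"
  using assms unfolding equivalent_def by blast

lemma equivalentE:
  assumes "equivalent n E F"
  obtains p q r c where "p permutes {..<n}" "q permutes {..<n}"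
    and "\<And>i j. i < n \<Longrightarrow> j < n \<Longrightarrow> F i j = E (p i) (q j) + r i + c j"
  using assms unfolding equivalent_def by blast

lemma permutes_less: "p permutes {..<n} \<Longrightarrow> i < n \<Longrightarrow> p i < (n :: nat)"
  by (metis lessThan_iff permutes_in_image)

lemma equivalent_cong:
  assumes "\<And>i j. i < n \<Longrightarrow> j < n \<Longrightarrow> F i j = E i j"
  shows "equivalent n E F"
  by (rule equivalentI[of id _ id _ _ "\<lambda>_. 0" "\<lambda>_. 0"]) (use assms in \<open>auto simp: permutes_id\<close>)

lemma equivalent_refl: "equivalent n E E"
  by (rule equivalent_cong) simp

lemma equivalent_sym:
  assumes "equivalent n E F"
  shows "equivalent n F E"
proof -
  obtain p q r c where pq: "p permutes {..<n}" "q permutes {..<n}"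
    and F: "\<And>i j. i < n \<Longrightarrow> j < n \<Longrightarrow> F i j = E (p i) (q j) + r i + c j"
    using assms by (rule equivalentE) (rule that)
  show ?thesis
  proof (rule equivalentI[OF permutes_inv[OF pq(1)] permutes_inv[OF pq(2)]])
    fix i j assume "i < n" "j < n"
    hence "F (inv_into UNIV p i) (inv_into UNIV q j) = E i j + r (inv_into UNIV p i) + c (inv_into UNIV q j)"
      using F[of "inv_into UNIV p i" "inv_into UNIV q j"] pq
      by (simp add: permutes_less permutes_inv permutes_inverses)
    thus "E i j = F (inv_into UNIV p i) (inv_into UNIV q j) + - r (inv_into UNIV p i) + - c (inv_into UNIV q j)"
      by simp
  qed
qed

lemma equivalent_trans:
  assumes "equivalent n E F" "equivalent n F G"
  shows "equivalent n E G"
proof -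
  obtain p q r c where pq: "p permutes {..<n}" "q permutes {..<n}"
    and F: "\<And>i j. i < n \<Longrightarrow> j < n \<Longrightarrow> F i j = E (p i) (q j) + r i + c j"
    using assms(1) by (rule equivalentE) (rule that)
  obtain p' q' r' c' where pq': "p' permutes {..<n}" "q' permutes {..<n}"
    and G: "\<And>i j. i < n \<Longrightarrow> j < n \<Longrightarrow> G i j = F (p' i) (q' j) + r' i + c' j"
    using assms(2) by (rule equivalentE) (rule that)
  show ?thesis
  proof (rule equivalentI[OF permutes_compose[OF pq'(1) pq(1)] permutes_compose[OF pq'(2) pq(2)]])
    fix i j assume "i < n" "j < n"
    thus "G i j = E ((p \<circ> p') i) ((q \<circ> q') j) + (r (p' i) + r' i) + (c (q' j) + c' j)"
      using pq' by (simp add: F G permutes_less algebra_simps)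
  qed
qed

text \<open>A common factor \<open>iu k\<close> is nonzero and a permutation only reorders the
  terms. This is the source of invariance both for orthogonality and for the triple counts.\<close>

lemma zero_sum_shift_permute:
  assumes "q permutes {..<n}"
  shows "(\<Sum>j<n. iu (k + f (q j))) = 0 \<longleftrightarrow> (\<Sum>j<n. iu (f j)) = 0"
proof -
  have "(\<Sum>j<n. iu (k + f (q j))) = iu k * (\<Sum>j<n. iu (f (q j)))"
    by (simp add: iu_add sum_distrib_left)
  also have "(\<Sum>j<n. iu (f (q j))) = (\<Sum>j<n. iu (f j))"
    using sum.permute[OF assms, of "\<lambda>j. iu (f j)"] by (simp add: o_def)
  finally show ?thesis
    by simp
qed

lemma equivalent_hadamard:
  assumes "equivalent n E F" "hadamard n E"
  shows "hadamard n F"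
proof -
  obtain p q r c where pq: "p permutes {..<n}" "q permutes {..<n}"
    and F: "\<And>i j. i < n \<Longrightarrow> j < n \<Longrightarrow> F i j = E (p i) (q j) + r i + c j"
    using assms(1) by (rule equivalentE) (rule that)
  show ?thesis
    unfolding hadamard_def
  proof (intro allI impI)
    fix i k assume ik: "i < n" "k < n" "i \<noteq> k"
    \<comment> \<open>The column constants cancel between the two rows; the row constants collect in
      a term independent of j.\<close>
    have "(\<Sum>j<n. iu (F i j - F k j)) =
        (\<Sum>j<n. iu ((r i - r k) + (E (p i) (q j) - E (p k) (q j))))"
      by (intro sum.cong refl arg_cong[where f = iu]) (use ik in \<open>simp add: F algebra_simps\<close>)
    moreover have "p i \<noteq> p k"
      using ik pq(1) by (metis permutes_inverses(2))
    ultimately show "(\<Sum>j<n. iu (F i j - F k j)) = 0"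
      using assms(2) ik pq
      by (simp add: zero_sum_shift_permute[OF pq(2), of _ "\<lambda>j. E (p i) j - E (p k) j"]
          hadamard_def permutes_less)
  qed
qed

section \<open>Translation between complex matrices and exponents\<close>

lemma mult_mat_adjoint_index:
  assumes "H \<in> carrier_mat n n" "i < n" "k < n"
  shows "(H * mat_adjoint H) $$ (i, k) = (\<Sum>j<n. H $$ (i, j) * cnj (H $$ (k, j)))"
proof -
  have "mat_adjoint H \<in> carrier_mat n n" "\<And>j. j < n \<Longrightarrow> mat_adjoint H $$ (j, k) = cnj (H $$ (k, j))"
    using assms by (auto simp: mat_adjoint_def mat_of_rows_def)
  thus ?thesis
    using assms by (simp add: scalar_prod_def lessThan_atLeast0)
qed

lemma exp_mat_carrier [simp]: "exp_mat n E \<in> carrier_mat n n"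
  by (simp add: exp_mat_def)

lemma exp_mat_index [simp]: "i < n \<Longrightarrow> j < n \<Longrightarrow> exp_mat n E $$ (i, j) = iu (E i j)"
  by (simp add: exp_mat_def)

lemma exp_mat_in_BH_iff: "exp_mat n E \<in> BH 4 n \<longleftrightarrow> hadamard n E"
proof -
  have entry: "(exp_mat n E * mat_adjoint (exp_mat n E)) $$ (i, k) = (\<Sum>j<n. iu (E i j - E k j))"
    if "i < n" "k < n" for i k
    using that by (simp add: mult_mat_adjoint_index[of _ n] iu_diff)
  have dims: "exp_mat n E * mat_adjoint (exp_mat n E) \<in> carrier_mat n n"
    by (rule mult_carrier_mat) (auto simp: mat_adjoint_def exp_mat_def)
  have "exp_mat n E * mat_adjoint (exp_mat n E) = of_nat n \<cdot>\<^sub>m 1\<^sub>m n \<longleftrightarrow> hadamard n E"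
  proof
    assume eq: "exp_mat n E * mat_adjoint (exp_mat n E) = of_nat n \<cdot>\<^sub>m 1\<^sub>m n"
    show "hadamard n E"
      unfolding hadamard_def
    proof (intro allI impI)
      fix i k assume "i < n" "k < n" "i \<noteq> k"
      thus "(\<Sum>j<n. iu (E i j - E k j)) = 0"
        using entry[of i k] by (simp add: eq)
    qed
  next
    assume h: "hadamard n E"
    show "exp_mat n E * mat_adjoint (exp_mat n E) = of_nat n \<cdot>\<^sub>m 1\<^sub>m n"
    proof (rule eq_matI)
      fix i k assume "i < dim_row (of_nat n \<cdot>\<^sub>m 1\<^sub>m n :: complex mat)"
        and "k < dim_col (of_nat n \<cdot>\<^sub>m 1\<^sub>m n :: complex mat)"
      thus "(exp_mat n E * mat_adjoint (exp_mat n E)) $$ (i, k) = (of_nat n \<cdot>\<^sub>m 1\<^sub>m n) $$ (i, k)"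
        using h by (cases "i = k") (simp_all add: entry hadamard_def)
    qed (use dims in auto)
  qed
  thus ?thesis
    by (simp add: BH_def complex_Hadamard_def)
qed

lemma BH_exp_mat:
  assumes "H \<in> BH 4 n"
  obtains E where "H = exp_mat n E" "hadamard n E"
proof -
  have "\<forall>i j. \<exists>x. i < n \<and> j < n \<longrightarrow> H $$ (i, j) = iu x"
    using assms fourth_root_of_unity_iu by (auto simp: BH_def)
  then obtain E where E: "\<And>i j. i < n \<Longrightarrow> j < n \<Longrightarrow> H $$ (i, j) = iu (E i j)"
    by metis
  have "H = exp_mat n E"
    using assms by (intro eq_matI) (auto simp: E BH_def complex_Hadamard_def exp_mat_def)
  thus thesis
    using that assms exp_mat_in_BH_iff by blast
qed

lemma permutation_mat_mult_left:
  assumes "p permutes {..<n}" "A \<in> carrier_mat n n"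
  shows "mat n n (\<lambda>(i, j). if j = p i then 1 else 0) * A = mat n n (\<lambda>(i, j). A $$ (p i, j) :: complex)"
  using assms
  by (intro eq_matI)
    (auto simp: scalar_prod_def if_distrib[of "\<lambda>x. x * _"] permutes_less cong: if_cong)

lemma permutation_mat_mult_right:
  assumes "p permutes {..<n}" "A \<in> carrier_mat n n"
  shows "A * mat n n (\<lambda>(i, j). if j = p i then 1 else 0) = mat n n (\<lambda>(i, j). A $$ (i, inv_into UNIV p j) :: complex)"
proof -
  have "j = p i \<longleftrightarrow> i = inv_into UNIV p j" for i j
    using permutes_inverses[OF assms(1)] by auto
  thus ?thesis
    using assms permutes_less[OF permutes_inv[OF assms(1)]]
    by (intro eq_matI)
      (auto simp: scalar_prod_def if_distrib[of "\<lambda>x. _ * x"] cong: if_cong)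
qed

lemma diagonal_mat_mult_left:
  assumes "D \<in> carrier_mat n n" "diagonal_mat D" "A \<in> carrier_mat n n"
  shows "D * A = mat n n (\<lambda>(i, j). D $$ (i, i) * A $$ (i, j) :: complex)"
proof (rule eq_matI)
  fix i j assume ij: "i < dim_row (mat n n (\<lambda>(i, j). D $$ (i, i) * A $$ (i, j)))"
    "j < dim_col (mat n n (\<lambda>(i, j). D $$ (i, i) * A $$ (i, j)))"
  have "(\<Sum>k\<in>{0..<n}. D $$ (i, k) * A $$ (k, j)) = (\<Sum>k\<in>{0..<n}. if k = i then D $$ (i, i) * A $$ (i, j) else 0)"
    using assms ij by (intro sum.cong) (auto simp: diagonal_mat_def)
  thus "(D * A) $$ (i, j) = mat n n (\<lambda>(i, j). D $$ (i, i) * A $$ (i, j)) $$ (i, j)"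
    using assms ij by (simp add: scalar_prod_def)
qed (use assms in auto)

lemma diagonal_mat_mult_right:
  assumes "D \<in> carrier_mat n n" "diagonal_mat D" "A \<in> carrier_mat n n"
  shows "A * D = mat n n (\<lambda>(i, j). A $$ (i, j) * D $$ (j, j) :: complex)"
proof (rule eq_matI)
  fix i j assume ij: "i < dim_row (mat n n (\<lambda>(i, j). A $$ (i, j) * D $$ (j, j)))"
    "j < dim_col (mat n n (\<lambda>(i, j). A $$ (i, j) * D $$ (j, j)))"
  have "(\<Sum>k\<in>{0..<n}. A $$ (i, k) * D $$ (k, j)) = (\<Sum>k\<in>{0..<n}. if k = j then A $$ (i, j) * D $$ (j, j) else 0)"
    using assms ij by (intro sum.cong) (auto simp: diagonal_mat_def)
  thus "(A * D) $$ (i, j) = mat n n (\<lambda>(i, j). A $$ (i, j) * D $$ (j, j)) $$ (i, j)"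
    using assms ij by (simp add: scalar_prod_def)
qed (use assms in auto)

lemma equivalence_product_index:
  fixes H D1 D2 :: "complex mat"
  assumes "p permutes {..<n}" "q permutes {..<n}" "H \<in> carrier_mat n n"
    and "D1 \<in> carrier_mat n n" "diagonal_mat D1" "D2 \<in> carrier_mat n n" "diagonal_mat D2"
    and "i < n" "j < n"
  shows "(mat n n (\<lambda>(i, j). if j = p i then 1 else 0) * D1 * H * D2 *
      mat n n (\<lambda>(i, j). if j = q i then 1 else 0)) $$ (i, j) =
    D1 $$ (p i, p i) * H $$ (p i, inv_into UNIV q j) * D2 $$ (inv_into UNIV q j, inv_into UNIV q j)"
proof -
  let ?P = "mat n n (\<lambda>(i, j). if j = p i then 1 else 0) :: complex mat"
  have "?P * D1 * H * D2 = ?P * (D1 * H * D2)"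
    using assms(3,4,6) by (simp add: assoc_mult_mat[of _ n n _ n _ n])
  thus ?thesis
    using assms permutes_less[OF permutes_inv[OF assms(2)]]
    by (simp add: permutation_mat_mult_right permutation_mat_mult_left
        diagonal_mat_mult_right[of _ n] diagonal_mat_mult_left[of _ n] permutes_less)
qed

lemma unitary_diagonal_iu: "unitary_diagonal n (mat n n (\<lambda>(i, j). if i = j then iu (f i) else 0))"
proof -
  define D where "D = mat n n (\<lambda>(i, j). if i = j then iu (f i) else 0)"
  have D: "D \<in> carrier_mat n n"
    by (simp add: D_def)
  have idx: "D $$ (i, j) = (if i = j then iu (f i) else 0)" if "i < n" "j < n" for i j
    using that by (simp add: D_def)
  have "D * mat_adjoint D = 1\<^sub>m n"
  proof (rule eq_matI)
    fix i k assume "i < dim_row (1\<^sub>m n :: complex mat)" "k < dim_col (1\<^sub>m n :: complex mat)"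
    hence ik: "i < n" "k < n"
      by auto
    hence "(D * mat_adjoint D) $$ (i, k) =
        (\<Sum>j<n. if j = i then (if i = k then iu (f i) * cnj (iu (f i)) else 0) else 0)"
      unfolding mult_mat_adjoint_index[OF D ik] by (intro sum.cong) (auto simp: idx)
    thus "(D * mat_adjoint D) $$ (i, k) = 1\<^sub>m n $$ (i, k)"
      using ik by simp
  qed (use D in \<open>auto simp: mat_adjoint_def\<close>)
  thus ?thesis
    using D unfolding unitary_diagonal_def diagonal_mat_def D_def[symmetric] by (auto simp: idx)
qed

text \<open>The diagonal matrices of the equivalence are arbitrary unitary ones, but the quotients
  \<open>d\<^sub>i e\<^sub>j\<close> of entries of two \<open>BH(4,n)\<close> matrices are fourth roots of unity, so
  \<open>d\<^sub>i e\<^sub>j = (d\<^sub>i e\<^sub>0) (d\<^sub>0 e\<^sub>0)\<^sup>-\<^sup>1 (d\<^sub>0 e\<^sub>j)\<close> lets us replace them by diagonals of fourth roots of unity.\<close>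

lemma Hadamard_equiv_exp_mat_iff:
  assumes "hadamard n E" "hadamard n F"
  shows "(exp_mat n E, exp_mat n F) \<in> Hadamard_equiv n \<longleftrightarrow> equivalent n E F"
proof
  assume "(exp_mat n E, exp_mat n F) \<in> Hadamard_equiv n"
  then obtain P1 P2 D1 D2 where P: "permutation_matrix n P1" "permutation_matrix n P2"
    and D: "unitary_diagonal n D1" "unitary_diagonal n D2"
    and eq0: "P1 * D1 * exp_mat n E * D2 * P2 = exp_mat n F"
    by (auto simp: Hadamard_equiv_def)
  from P obtain p q' where p: "p permutes {..<n}" and q': "q' permutes {..<n}"
    and P1: "P1 = mat n n (\<lambda>(i, j). if j = p i then 1 else 0)"
    and P2: "P2 = mat n n (\<lambda>(i, j). if j = q' i then 1 else 0)"
    by (auto simp: permutation_matrix_def)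
  note eq = eq0[unfolded P1 P2]
  define q d e where "q = inv_into UNIV q'" and "d i = D1 $$ (p i, p i)" and "e j = D2 $$ (q j, q j)" for i j
  have q: "q permutes {..<n}"
    unfolding q_def using q' by (rule permutes_inv)
  have F: "iu (F i j) = d i * iu (E (p i) (q j)) * e j" if "i < n" "j < n" for i j
    using equivalence_product_index[OF p q' exp_mat_carrier, of D1 D2 i j E] D that p q
    by (simp add: eq unitary_diagonal_def d_def e_def q_def permutes_less)
  define x where "x i j = F i j - E (p i) (q j)" for i j
  have x: "iu (x i j) = d i * e j" if "i < n" "j < n" for i j
  proof -
    have "iu (x i j) = d i * e j * (iu (E (p i) (q j)) * cnj (iu (E (p i) (q j))))"
      unfolding x_def iu_diff using F[OF that] by (simp only: mult_ac)
    thus ?thesis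
      by simp
  qed
  show "equivalent n E F"
  proof (rule equivalentI[OF p q])
    fix i j assume ij: "i < n" "j < n"
    hence n: "0 < n"
      by simp
    have "iu (x i j + x 0 0) = iu (x i 0 + x 0 j)"
      using ij n by (simp add: iu_add x)
    hence "x i j + x 0 0 = x i 0 + x 0 j"
      by simp
    hence "x i j = (x i 0 - x 0 0) + x 0 j"
      by (simp add: algebra_simps)
    thus "F i j = E (p i) (q j) + (x i 0 - x 0 0) + x 0 j"
      unfolding x_def[of i j] by (simp add: algebra_simps)
  qed
next
  assume "equivalent n E F"
  then obtain p q r c where pq: "p permutes {..<n}" "q permutes {..<n}"
    and F: "\<And>i j. i < n \<Longrightarrow> j < n \<Longrightarrow> F i j = E (p i) (q j) + r i + c j"
    by (rule equivalentE) (rule that)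
  \<comment> \<open>The diagonals act before the permutations, so the constant of the new row i has
    to sit at position \<open>p i\<close>, and that of the new column j at \<open>q j\<close>; hence
    the inverses. \<open>P2\<close> is built from the inverse of \<open>q\<close> because right
    multiplication permutes columns by the inverse.\<close>
  define D1 D2 P1 P2 where "D1 = mat n n (\<lambda>(i, j). if i = j then iu (r (inv_into UNIV p i)) else 0)"
    and "D2 = mat n n (\<lambda>(i, j). if i = j then iu (c (inv_into UNIV q i)) else 0)"
    and "P1 = (mat n n (\<lambda>(i, j). if j = p i then 1 else 0) :: complex mat)"
    and "P2 = (mat n n (\<lambda>(i, j). if j = inv_into UNIV q i then 1 else 0) :: complex mat)"
  have D: "unitary_diagonal n D1" "unitary_diagonal n D2"
    unfolding D1_def D2_def by (rule unitary_diagonal_iu)+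
  have P: "permutation_matrix n P1" "permutation_matrix n P2"
    unfolding permutation_matrix_def P1_def P2_def using pq permutes_inv by blast+
  have "P1 * D1 * exp_mat n E * D2 * P2 = exp_mat n F"
  proof (rule eq_matI)
    fix i j assume "i < dim_row (exp_mat n F)" "j < dim_col (exp_mat n F)"
    hence ij: "i < n" "j < n"
      by (auto simp: exp_mat_def)
    have "(P1 * D1 * exp_mat n E * D2 * P2) $$ (i, j) =
        D1 $$ (p i, p i) * exp_mat n E $$ (p i, q j) * D2 $$ (q j, q j)"
      using equivalence_product_index[OF pq(1) permutes_inv[OF pq(2)] exp_mat_carrier, of D1 D2 i j E] D ij
      by (simp add: P1_def P2_def unitary_diagonal_def permutes_inv_inv[OF pq(2)])
    also have "\<dots> = iu (r i) * iu (E (p i) (q j)) * iu (c j)"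
      using ij pq by (simp add: D1_def D2_def permutes_less permutes_inverses)
    also have "\<dots> = exp_mat n F $$ (i, j)"
      using ij by (simp add: F iu_add)
    finally show "(P1 * D1 * exp_mat n E * D2 * P2) $$ (i, j) = exp_mat n F $$ (i, j)" .
  qed (auto simp: P1_def P2_def exp_mat_def)
  thus "(exp_mat n E, exp_mat n F) \<in> Hadamard_equiv n"
    using assms D P exp_mat_in_BH_iff unfolding Hadamard_equiv_def BH_def by blast
qed

section \<open>Extending partial matrices\<close>

text \<open>The real part of a sum of fourth roots of unity is the number of \<open>Z0\<close> minus
  that of \<open>Z2\<close>, the imaginary part the number of \<open>Z1\<close> minus that of
  \<open>Z3\<close>. Four counters therefore decide whether the sum vanishes.\<close>

fun balanced_acc :: "z4 list \<Rightarrow> nat \<Rightarrow> nat \<Rightarrow> nat \<Rightarrow> nat \<Rightarrow> bool" where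
  "balanced_acc [] a b c d \<longleftrightarrow> a = c \<and> b = d"
| "balanced_acc (Z0 # xs) a b c d = balanced_acc xs (Suc a) b c d"
| "balanced_acc (Z1 # xs) a b c d = balanced_acc xs a (Suc b) c d"
| "balanced_acc (Z2 # xs) a b c d = balanced_acc xs a b (Suc c) d"
| "balanced_acc (Z3 # xs) a b c d = balanced_acc xs a b c (Suc d)"

fun vdiff :: "z4 list \<Rightarrow> z4 list \<Rightarrow> z4 list" where
  "vdiff (x # xs) (y # ys) = (x - y) # vdiff xs ys"
| "vdiff _ _ = []"

definition orth :: "z4 list \<Rightarrow> z4 list \<Rightarrow> bool" where
  "orth u v = balanced_acc (vdiff u v) 0 0 0 0"

fun z4_le :: "z4 \<Rightarrow> z4 \<Rightarrow> bool" where
  "z4_le Z0 y = True"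
| "z4_le Z1 y = (y \<noteq> Z0)"
| "z4_le Z2 y = (y = Z2 \<or> y = Z3)"
| "z4_le Z3 y = (y = Z3)"

text \<open>A flag demands order between two neighbouring entries. The empty list of flags imposes
  nothing, which is how the completion step switches sorting off.\<close>

fun sorted_on_blocks :: "bool list \<Rightarrow> z4 list \<Rightarrow> bool" where
  "sorted_on_blocks (e # es) (x # y # v) \<longleftrightarrow> (e \<longrightarrow> z4_le x y) \<and> sorted_on_blocks es (y # v)"
| "sorted_on_blocks _ _ = True"

text \<open>Blocks are runs of adjacent equal columns; equal columns separated by a different one
  count as different blocks.\<close>

definition repeated_cols :: "nat \<Rightarrow> z4 list list \<Rightarrow> bool list" where
  "repeated_cols m R = map (\<lambda>j. list_all (\<lambda>r. r ! j = r ! Suc j) R) [0..<m]"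

definition admissible :: "bool list \<Rightarrow> z4 list list \<Rightarrow> z4 list \<Rightarrow> bool" where
  "admissible es R v \<longleftrightarrow> sorted_on_blocks es v \<and> list_all (orth v) R"

text \<open>\<open>words es R m a b c d v acc\<close> prefixes \<open>v\<close> by \<open>Z0\<close> and all words of length \<open>m\<close> with
  \<open>a, b, c, d\<close> letters \<open>Z0, Z1, Z2, Z3\<close>, and adds the admissible results to \<open>acc\<close>. The
  recursive call is handed to \<open>use_Z0, \<dots>, use_Z3\<close> as a partial application because symbolic evaluation would unfold it inside an abstraction.\<close>

type_synonym word_search = "nat \<Rightarrow> nat \<Rightarrow> nat \<Rightarrow> nat \<Rightarrow> z4 list \<Rightarrow> z4 list list \<Rightarrow> z4 list list"

fun use_Z0 :: "word_search \<Rightarrow> word_search" where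
  "use_Z0 W 0 b c d v acc = acc"
| "use_Z0 W (Suc a) b c d v acc = W a b c d (Z0 # v) acc"

fun use_Z1 :: "word_search \<Rightarrow> word_search" where
  "use_Z1 W a 0 c d v acc = acc"
| "use_Z1 W a (Suc b) c d v acc = W a b c d (Z1 # v) acc"

fun use_Z2 :: "word_search \<Rightarrow> word_search" where
  "use_Z2 W a b 0 d v acc = acc"
| "use_Z2 W a b (Suc c) d v acc = W a b c d (Z2 # v) acc"

fun use_Z3 :: "word_search \<Rightarrow> word_search" where
  "use_Z3 W a b c 0 v acc = acc"
| "use_Z3 W a b c (Suc d) v acc = W a b c d (Z3 # v) acc"

primrec words :: "bool list \<Rightarrow> z4 list list \<Rightarrow> nat \<Rightarrow> word_search" where
  "words es R 0 a b c d v acc = (if admissible es R (Z0 # v) then (Z0 # v) # acc else acc)"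
| "words es R (Suc m) a b c d v acc =
     use_Z0 (words es R m) a b c d v (use_Z1 (words es R m) a b c d v
       (use_Z2 (words es R m) a b c d v (use_Z3 (words es R m) a b c d v acc)))"

text \<open>A balanced row has as many \<open>Z0\<close> as \<open>Z2\<close> and as many
  \<open>Z1\<close> as \<open>Z3\<close>. One \<open>Z0\<close> is the leading letter, so the other
  letters contain \<open>a\<close>, \<open>b\<close>, \<open>Suc a\<close>, \<open>b\<close> of each
  kind; the loop runs through all such pairs with \<open>Suc a + b\<close> fixed.\<close>

fun all_words :: "bool list \<Rightarrow> z4 list list \<Rightarrow> nat \<Rightarrow> nat \<Rightarrow> nat \<Rightarrow> z4 list list \<Rightarrow> z4 list list" where
  "all_words es R m 0 b acc = acc"
| "all_words es R m (Suc a) b acc = all_words es R m a (Suc b) (words es R m a b (Suc a) b [] acc)"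

text \<open>The first row of \<open>R\<close> is meant to be zero. Orthogonality to it is balance of
  the word, which the letter counts already enforce, so only \<open>tl R\<close> is tested.\<close>

definition candidates :: "nat \<Rightarrow> bool list \<Rightarrow> z4 list list \<Rightarrow> z4 list list" where
  "candidates n es R = all_words es (tl R) (n - 1) (n div 2) 0 []"

fun cliques :: "nat \<Rightarrow> z4 list list \<Rightarrow> z4 list list list" where
  "cliques 0 C = [[]]"
| "cliques (Suc m) [] = []"
| "cliques (Suc m) (v # C) = map ((#) v) (cliques m (filter (orth v) C)) @ cliques (Suc m) C"

definition is_perm :: "nat \<Rightarrow> nat list \<Rightarrow> bool" where
  "is_perm k p \<longleftrightarrow> length p = k \<and> distinct p \<and> list_all (\<lambda>i. i < k) p"

definition rearrange :: "nat list \<Rightarrow> nat list \<Rightarrow> z4 list list \<Rightarrow> z4 list list" where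
  "rearrange p q M = map (\<lambda>i. map ((!) (M ! i)) q) p"

fun normalize_row :: "z4 list \<Rightarrow> z4 list" where
  "normalize_row (x # xs) = 0 # map (\<lambda>y. y - x) xs"
| "normalize_row [] = []"

fun normalize :: "z4 list list \<Rightarrow> z4 list list" where
  "normalize (r # M) = map (\<lambda>s. normalize_row (vdiff s r)) (r # M)"
| "normalize [] = []"

definition leads_to :: "nat \<Rightarrow> z4 list list list \<Rightarrow> z4 list list \<Rightarrow> nat list \<times> nat list \<Rightarrow> bool" where
  "leads_to n L M pq \<longleftrightarrow> (case pq of (p, q) \<Rightarrow>
     is_perm (length M) p \<and> is_perm n q \<and> normalize (rearrange p q M) \<in> set L)"

text \<open>Certificates are matched with candidates by position, and \<open>list_all2\<close>
  forces equal lengths, so no candidate goes unchecked. The test on \<open>hd R\<close> justifies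
  the treatment of the first row in \<open>candidates\<close>.\<close>

definition row_step :: "nat \<Rightarrow> z4 list list list \<Rightarrow> z4 list list \<Rightarrow> (nat list \<times> nat list) list \<Rightarrow> bool" where
  "row_step n L R certs \<longleftrightarrow> hd R = replicate n Z0 \<and>
     list_all2 (\<lambda>v. leads_to n L (R @ [v])) (candidates n (repeated_cols (n - 1) R) R) certs"

text \<open>No sorting here: a column permutation that sorts one of the new rows may unsort the
  others.\<close>

definition completion_step :: "nat \<Rightarrow> z4 list list list \<Rightarrow> z4 list list \<Rightarrow> (nat list \<times> nat list) list \<Rightarrow> bool" where
  "completion_step n L R certs \<longleftrightarrow> hd R = replicate n Z0 \<and>
     list_all2 (\<lambda>S. leads_to n L (R @ S)) (cliques (n - length R) (candidates n [] R)) certs"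

section \<open>Meaning of the executable functions on lists\<close>

definition row_lists :: "nat \<Rightarrow> nat \<Rightarrow> (nat \<Rightarrow> nat \<Rightarrow> z4) \<Rightarrow> z4 list list" where
  "row_lists n k E = map (\<lambda>i. map (E i) [0..<n]) [0..<k]"

lemma length_row_lists [simp]: "length (row_lists n k E) = k"
  by (simp add: row_lists_def)

lemma nth_row_lists [simp]: "i < k \<Longrightarrow> row_lists n k E ! i = map (E i) [0..<n]"
  by (simp add: row_lists_def)

lemma row_lists_cong:
  assumes "\<And>i j. i < k \<Longrightarrow> j < n \<Longrightarrow> E i j = F i j"
  shows "row_lists n k E = row_lists n k F"
  using assms by (auto simp: row_lists_def)

lemma row_lists_Suc: "row_lists n (Suc k) E = row_lists n k E @ [map (E k) [0..<n]]"
  by (simp add: row_lists_def)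

lemma sum_list_row_lists: "(\<Sum>r\<leftarrow>row_lists n k E. f r) = (\<Sum>i<k. f (map (E i) [0..<n]))"
  by (simp add: row_lists_def o_def interv_sum_list_conv_sum_set_nat lessThan_atLeast0)

lemma balanced_acc_iff_count:
  "balanced_acc xs a b c d \<longleftrightarrow>
    a + count_list xs Z0 = c + count_list xs Z2 \<and> b + count_list xs Z1 = d + count_list xs Z3"
  by (induction xs a b c d rule: balanced_acc.induct) auto

lemma sum_list_iu:
  "(\<Sum>x\<leftarrow>xs. iu x) = Complex (real (count_list xs Z0) - real (count_list xs Z2))
    (real (count_list xs Z1) - real (count_list xs Z3))"
proof (induction xs)
  case (Cons x xs)
  thus ?case
    by (cases x) (simp_all add: complex_eq_iff)
qed (simp add: zero_complex.code)

lemma balanced_iff: "balanced_acc xs 0 0 0 0 \<longleftrightarrow> (\<Sum>x\<leftarrow>xs. iu x) = 0"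
  by (auto simp: balanced_acc_iff_count sum_list_iu complex_eq_iff)

lemma vdiff_map: "vdiff (map f xs) (map g xs) = map (\<lambda>x. f x - g x) xs"
  by (induction xs) auto

lemma orth_map_iff:
  "orth (map f [0..<n]) (map g [0..<n]) \<longleftrightarrow> (\<Sum>j<n. iu (f j - g j)) = 0"
  by (simp add: orth_def vdiff_map balanced_iff o_def interv_sum_list_conv_sum_set_nat lessThan_atLeast0)

lemma length_eq_sum_counts:
  "length xs = count_list xs Z0 + count_list xs Z1 + count_list xs Z2 + count_list xs Z3"
proof (induction xs)
  case (Cons x xs)
  thus ?case
    by (cases x) simp_all
qed simp

text \<open>The four branches of \<open>words\<close> are chained through the accumulator, so a word
  found by an inner branch has to survive the outer ones.\<close>

lemma use_mono:
  assumes "\<And>a b c d v acc. set acc \<subseteq> set (W a b c d v acc)"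
  shows "set acc \<subseteq> set (use_Z0 W a b c d v acc)" "set acc \<subseteq> set (use_Z1 W a b c d v acc)"
    "set acc \<subseteq> set (use_Z2 W a b c d v acc)" "set acc \<subseteq> set (use_Z3 W a b c d v acc)"
  subgoal by (cases a) (use assms in simp_all)
  subgoal by (cases b) (use assms in simp_all)
  subgoal by (cases c) (use assms in simp_all)
  subgoal by (cases d) (use assms in simp_all)
  done

lemma words_mono: "set acc \<subseteq> set (words es R m a b c d v acc)"
proof (induction m arbitrary: a b c d v acc)
  case 0
  show ?case
    by auto
next
  case (Suc m)
  show ?case
    using use_mono[OF Suc.IH] by (simp, meson order_trans)
qed

lemma words_complete:
  assumes "length w = m" "count_list w Z0 = a" "count_list w Z1 = b" "count_list w Z2 = c"
    "count_list w Z3 = d" "admissible es R (Z0 # w @ v)"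
  shows "Z0 # w @ v \<in> set (words es R m a b c d v acc)"
  using assms
proof (induction m arbitrary: w a b c d v acc)
  case 0
  thus ?case
    by simp
next
  case (Suc m)
  \<comment> \<open>\<open>words\<close> builds a word from its right end, so the last letter is the
    one chosen first.\<close>
  then obtain w' x where w: "w = w' @ [x]"
    by (cases w rule: rev_cases) auto
  have counts: "a = count_list w' Z0 + (if x = Z0 then 1 else 0)"
    "b = count_list w' Z1 + (if x = Z1 then 1 else 0)"
    "c = count_list w' Z2 + (if x = Z2 then 1 else 0)"
    "d = count_list w' Z3 + (if x = Z3 then 1 else 0)"
    using Suc.prems w by auto
  have IH: "Z0 # w @ v \<in> set (words es R m (count_list w' Z0) (count_list w' Z1)
      (count_list w' Z2) (count_list w' Z3) (x # v) acc')" for acc'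
    using Suc.IH[of w' _ _ _ _ "x # v"] Suc.prems w by simp
  note mono = use_mono[where W = "words es R m", OF words_mono, THEN subsetD]
  show ?case
  proof (cases x)
    case Z0
    thus ?thesis
      using IH counts by simp
  next
    case Z1
    hence "Z0 # w @ v \<in> set (use_Z1 (words es R m) a b c d v acc')" for acc'
      using IH counts by simp
    thus ?thesis
      by (simp add: mono(1))
  next
    case Z2
    hence "Z0 # w @ v \<in> set (use_Z2 (words es R m) a b c d v acc')" for acc'
      using IH counts by simp
    thus ?thesis
      by (simp add: mono(1,2))
  next
    case Z3
    hence "Z0 # w @ v \<in> set (use_Z3 (words es R m) a b c d v acc')" for acc'
      using IH counts by simp
    thus ?thesis
      by (simp add: mono(1,2,3))
  qed
qed

lemma all_words_mono: "set acc \<subseteq> set (all_words es R m a b acc)"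
  by (induction a arbitrary: b acc) (auto dest: words_mono[THEN subsetD])

text \<open>\<open>a + b\<close> is constant along the loop while \<open>a\<close> decreases by one,
  so the loop passes through the letter counts of \<open>w\<close>.\<close>

lemma all_words_complete:
  assumes "length w = m" "admissible es R (Z0 # w)"
    and "count_list w Z0 = a'" "count_list w Z1 = b'" "count_list w Z2 = Suc a'" "count_list w Z3 = b'"
    and "a' < a" "a' + b' + 1 = a + b"
  shows "Z0 # w \<in> set (all_words es R m a b acc)"
  using assms
proof (induction a arbitrary: b acc)
  case (Suc a)
  show ?case
  proof (cases "a' = a")
    case True
    hence "Z0 # w \<in> set (words es R m a b (Suc a) b [] acc)"
      using Suc.prems words_complete[of w m a b "Suc a" b es R "[]"] by simp
    thus ?thesis
      by (simp add: all_words_mono[THEN subsetD])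
  qed (use Suc in simp)
qed simp

lemma candidates_complete:
  assumes "length v = n" "0 < n" "v ! 0 = Z0" "balanced_acc v 0 0 0 0" "admissible es (tl R) v"
  shows "v \<in> set (candidates n es R)"
proof -
  obtain w where v: "v = Z0 # w"
    using assms(1-3) by (cases v) auto
  \<comment> \<open>Balance makes n twice the number of letters \<open>Z0\<close> and
    \<open>Z1\<close> in \<open>v\<close>; the \<open>Suc\<close> accounts for the leading
    \<open>Z0\<close>.\<close>
  have "n div 2 = Suc (count_list w Z0) + count_list w Z1"
    and "count_list w Z2 = Suc (count_list w Z0)" "count_list w Z3 = count_list w Z1"
    using assms(1,4) length_eq_sum_counts[of v] by (auto simp: v balanced_acc_iff_count)
  thus ?thesis
    using assms(1,5) unfolding candidates_def v
    by (intro all_words_complete[OF _ _ refl refl]) auto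
qed

lemma length_cliques: "xs \<in> set (cliques m C) \<Longrightarrow> length xs = m"
  by (induction m C arbitrary: xs rule: cliques.induct) auto

text \<open>If the head belongs to \<open>S\<close>, the rest of \<open>S\<close> survives the
  filter by orthogonality; otherwise \<open>S\<close> lies in the tail. A clique is listed in the
  order of \<open>C\<close>, hence the conclusion about sets only.\<close>

lemma cliques_complete:
  assumes "S \<subseteq> set C" "card S = m" "\<And>u v. u \<in> S \<Longrightarrow> v \<in> S \<Longrightarrow> u \<noteq> v \<Longrightarrow> orth u v"
  shows "\<exists>xs \<in> set (cliques m C). set xs = S"
  using assms
proof (induction m C arbitrary: S rule: cliques.induct)
  case (1 C)
  thus ?case
    using finite_subset[OF "1.prems"(1)] by simp
next
  case (2 m)
  thus ?case
    by simp
next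
  case (3 m v C)
  show ?case
  proof (cases "v \<in> S")
    case True
    have "finite S"
      using "3.prems"(1) finite_subset by blast
    have "\<exists>xs \<in> set (cliques m (filter (orth v) C)). set xs = S - {v}"
    proof (rule "3.IH"(1))
      show "S - {v} \<subseteq> set (filter (orth v) C)"
        using "3.prems"(1,3) True by auto
      show "card (S - {v}) = m"
        using "3.prems"(2) True \<open>finite S\<close> by simp
    qed (use "3.prems"(3) in auto)
    then obtain xs where "xs \<in> set (cliques m (filter (orth v) C))" "set xs = S - {v}"
      by blast
    hence "v # xs \<in> set (cliques (Suc m) (v # C))" "set (v # xs) = S"
      using True by auto
    thus ?thesis
      by blast
  next
    case False
    hence "\<exists>xs \<in> set (cliques (Suc m) C). set xs = S"
      using "3.prems" by (intro "3.IH"(2)) auto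
    thus ?thesis
      by auto
  qed
qed

text \<open>Being the identity beyond the list, a rearrangement of the first k rows is also a
  permutation of all n rows.\<close>

definition list_perm :: "nat list \<Rightarrow> nat \<Rightarrow> nat" where
  "list_perm p i = (if i < length p then p ! i else i)"

lemma list_perm_permutes:
  assumes "is_perm k p"
  shows "list_perm p permutes {..<k}"
proof (rule bij_imp_permutes)
  have p: "length p = k" "distinct p" "set p \<subseteq> {..<k}"
    using assms by (auto simp: is_perm_def list_all_iff)
  have "set p = {..<k}"
    using p by (intro card_subset_eq) (auto simp: distinct_card)
  hence "bij_betw ((!) p) {..<k} {..<k}"
    using p by (intro bij_betw_nth) auto
  thus "bij_betw (list_perm p) {..<k} {..<k}"
    using p(1) by (subst bij_betw_cong[of _ _ "(!) p"]) (auto simp: list_perm_def)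
  show "list_perm p i = i" if "i \<notin> {..<k}" for i
    using that p(1) by (simp add: list_perm_def)
qed

lemma rearrange_row_lists:
  assumes "is_perm k p" "is_perm n q"
  shows "rearrange p q (row_lists n k E) = row_lists n k (\<lambda>i j. E (list_perm p i) (list_perm q j))"
proof (rule nth_equalityI)
  have pq: "length p = k" "length q = n"
    using assms by (auto simp: is_perm_def)
  thus "length (rearrange p q (row_lists n k E)) = length (row_lists n k (\<lambda>i j. E (list_perm p i) (list_perm q j)))"
    by (simp add: rearrange_def)
  fix i assume "i < length (rearrange p q (row_lists n k E))"
  hence i: "i < k"
    using pq by (simp add: rearrange_def)
  hence "p ! i < k"
    using assms(1) by (auto simp: is_perm_def list_all_iff)
  moreover have "q ! j < n" if "j < n" for j
    using assms(2) that by (auto simp: is_perm_def list_all_iff)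
  ultimately show "rearrange p q (row_lists n k E) ! i = row_lists n k (\<lambda>i j. E (list_perm p i) (list_perm q j)) ! i"
    using pq i by (intro nth_equalityI) (auto simp: rearrange_def list_perm_def)
qed

lemma normalize_row_map:
  assumes "0 < n"
  shows "normalize_row (map f [0..<n]) = map (\<lambda>j. f j - f 0) [0..<n]"
  using assms by (simp add: upt_conv_Cons)

lemma normalize_row_lists:
  assumes "0 < k" "0 < n"
  shows "normalize (row_lists n k E) = row_lists n k (\<lambda>i j. E i j - E 0 j - (E i 0 - E 0 0))"
proof -
  have "normalize M = map (\<lambda>s. normalize_row (vdiff s (hd M))) M" for M
    by (cases M) simp_all
  moreover have "hd (row_lists n k E) = map (E 0) [0..<n]"
    using assms by (simp add: hd_conv_nth flip: length_0_conv)
  ultimately show ?thesis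
    using assms by (simp add: row_lists_def vdiff_map normalize_row_map)
qed

lemma list_all2_in_set: "list_all2 P xs ys \<Longrightarrow> x \<in> set xs \<Longrightarrow> \<exists>y. P x y"
  by (induction rule: list_all2_induct) auto

definition covered_by :: "nat \<Rightarrow> nat \<Rightarrow> z4 list list list \<Rightarrow> bool" where
  "covered_by n k L \<longleftrightarrow> (\<forall>E. hadamard n E \<longrightarrow> (\<exists>F. equivalent n E F \<and> row_lists n k F \<in> set L))"

text \<open>Rearranging and normalizing a partial matrix is the restriction of an equivalence of the
  whole matrix, whose unknown rows are carried along.\<close>

lemma leads_to_sound:
  assumes "leads_to n L (row_lists n k F) pq" "0 < k" "k \<le> n"
  shows "\<exists>G. equivalent n F G \<and> row_lists n k G \<in> set L"
proof -
  obtain p q where p: "is_perm k p" and q: "is_perm n q"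
    and L: "normalize (rearrange p q (row_lists n k F)) \<in> set L"
    using assms(1) by (auto simp: leads_to_def)
  define H where "H i j = F (list_perm p i) (list_perm q j)" for i j
  \<comment> \<open>Normalization as row and column constants: \<open>- H 0 j\<close> clears the
    first row, \<open>H 0 0 - H i 0\<close> then clears the first column.\<close>
  define G where "G i j = H i j + (H 0 0 - H i 0) + - H 0 j" for i j
  have "row_lists n k (\<lambda>i j. H i j - H 0 j - (H i 0 - H 0 0)) = row_lists n k G"
    by (rule row_lists_cong) (simp add: G_def algebra_simps)
  hence "row_lists n k G \<in> set L"
    using L assms(2,3) unfolding rearrange_row_lists[OF p q] H_def[symmetric]
    by (simp add: normalize_row_lists)
  moreover have "list_perm p permutes {..<n}"
    using list_perm_permutes[OF p] by (rule permutes_subset) (use assms(3) in auto)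
  hence "equivalent n F G"
    using list_perm_permutes[OF q] unfolding G_def H_def by (rule equivalentI) (rule refl)
  ultimately show ?thesis
    by blast
qed

lemma covered_by_zero_row:
  assumes "0 < n"
  shows "covered_by n 1 [[replicate n Z0]]"
  unfolding covered_by_def
proof (intro allI impI exI conjI)
  fix E
  show "equivalent n E (\<lambda>i j. E i j + - E 0 j)"
    by (rule equivalentI[OF permutes_id permutes_id, where r = "\<lambda>_. 0" and c = "\<lambda>j. - E 0 j"]) simp
  have "x + - x = Z0" for x :: z4
    by (simp flip: zero_z4_def)
  thus "row_lists n 1 (\<lambda>i j. E i j + - E 0 j) \<in> set [[replicate n Z0]]"
    by (simp add: row_lists_def map_replicate_const)
qed

lemma hadamard_orth:
  assumes "hadamard n E" "i < n" "k < n" "i \<noteq> k"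
  shows "orth (map (E i) [0..<n]) (map (E k) [0..<n])"
  using assms by (simp add: orth_map_iff hadamard_def)

text \<open>Shared by both kinds of step: \<open>i\<close> is any row beyond the first k, and
  \<open>es\<close> is either the list of flags for the blocks or empty.\<close>

lemma row_in_candidates:
  assumes "hadamard n E" "k \<le> i" "i < n" "0 < k" "E i 0 = Z0"
    and "hd (row_lists n k E) = replicate n Z0" "sorted_on_blocks es (map (E i) [0..<n])"
  shows "map (E i) [0..<n] \<in> set (candidates n es (row_lists n k E))"
proof (rule candidates_complete)
  have "map (E 0) [0..<n] = replicate n Z0"
    using assms(4,6) by (simp add: hd_conv_nth flip: length_0_conv)
  hence zero: "E 0 j = 0" if "j < n" for j
    using that by (auto simp: map_eq_conv zero_z4_def dest!: arg_cong[of _ _ "\<lambda>xs. xs ! j"])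
  have "(\<Sum>j<n. iu (E i j - E 0 j)) = 0"
    using assms(1-4) by (simp add: hadamard_def)
  thus "balanced_acc (map (E i) [0..<n]) 0 0 0 0"
    by (simp add: zero balanced_iff o_def interv_sum_list_conv_sum_set_nat lessThan_atLeast0)
  have "set (tl xs) \<subseteq> set xs" for xs :: "z4 list list"
    by (cases xs) auto
  hence "set (tl (row_lists n k E)) \<subseteq> (\<lambda>l. map (E l) [0..<n]) ` {..<k}"
    by (fastforce simp: row_lists_def)
  thus "admissible es (tl (row_lists n k E)) (map (E i) [0..<n])"
    using assms(1-3,7) by (auto simp: admissible_def list_all_iff intro!: hadamard_orth dest!: subsetD)
qed (use assms in auto)

section \<open>Sorting columns inside blocks\<close>

fun z4_nat :: "z4 \<Rightarrow> nat" where
  "z4_nat Z0 = 0" | "z4_nat Z1 = 1" | "z4_nat Z2 = 2" | "z4_nat Z3 = 3"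

lemma z4_nat_less: "z4_nat x < 4"
  by (cases x) auto

lemma z4_le_iff: "z4_le x y \<longleftrightarrow> z4_nat x \<le> z4_nat y"
  by (cases x; cases y; simp)

lemma sorted_on_blocks_iff:
  "length v = Suc (length es) \<Longrightarrow>
    sorted_on_blocks es v \<longleftrightarrow> (\<forall>j<length es. es ! j \<longrightarrow> z4_le (v ! j) (v ! Suc j))"
proof (induction es v rule: sorted_on_blocks.induct)
  case (1 e es x y v)
  thus ?case
    by (auto simp: less_Suc_eq_0_disj)
qed auto

lemma sorted_map_iff_mono: "sorted (map f [0..<n]) \<longleftrightarrow> (\<forall>i j. i \<le> j \<longrightarrow> j < n \<longrightarrow> f i \<le> f j)"
  by (auto simp: sorted_iff_nth_mono)

text \<open>Sorting the columns by \<open>4 \<kappa> + v\<close>, where \<open>\<kappa>\<close> numbers the blocks of equal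
  adjacent columns, permutes columns only within these blocks.\<close>

lemma sort_within_blocks:
  fixes v :: "nat \<Rightarrow> z4"
  assumes block: "\<And>i j. i < n \<Longrightarrow> j < n \<Longrightarrow> \<kappa> i = \<kappa> j \<Longrightarrow> B i = B j"
    and mono: "\<And>i j. i \<le> j \<Longrightarrow> j < n \<Longrightarrow> \<kappa> i \<le> (\<kappa> j :: nat)"
  obtains q where "q permutes {..<n}" "\<And>j. j < n \<Longrightarrow> \<kappa> (q j) = \<kappa> j" "\<And>j. j < n \<Longrightarrow> B (q j) = B j"
    and "\<And>i j. i \<le> j \<Longrightarrow> j < n \<Longrightarrow> \<kappa> i = \<kappa> j \<Longrightarrow> z4_le (v (q i)) (v (q j))"
proof -
  define w where "w j = 4 * \<kappa> j + z4_nat (v j)" for j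
  have "mset (sort (map w [0..<n])) = mset (map w [0..<n])"
    by simp
  then obtain q where "q permutes {..<length (map w [0..<n])}"
    and eq: "permute_list q (map w [0..<n]) = sort (map w [0..<n])"
    by (rule mset_eq_permutation)
  hence q: "q permutes {..<n}"
    by simp
  have "map (\<lambda>j. w (q j)) [0..<n] = sort (map w [0..<n])"
    using eq[symmetric] permutes_less[OF q] by (simp add: permute_list_def)
  hence sorted: "sorted (map (\<lambda>j. w (q j)) [0..<n])"
    by simp
  \<comment> \<open>As \<open>z4_nat\<close> stays below 4, division by 4 recovers the block number
    from the sorting key.\<close>
  have \<kappa>: "\<kappa> j = w j div 4" for j
    using z4_nat_less[of "v j"] by (simp add: w_def)
  have "sorted (map (\<lambda>j. \<kappa> (q j)) [0..<n])"
    using sorted unfolding sorted_map_iff_mono \<kappa> by (auto intro: div_le_mono)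
  moreover have "map (\<lambda>j. \<kappa> (q j)) [0..<n] = permute_list q (map \<kappa> [0..<n])"
    using permutes_less[OF q] by (simp add: permute_list_def)
  hence "mset (map (\<lambda>j. \<kappa> (q j)) [0..<n]) = mset (map \<kappa> [0..<n])"
    using q by (simp only: mset_permute_list length_map length_upt diff_zero)
  moreover have "sorted (map \<kappa> [0..<n])"
    using mono by (simp add: sorted_map_iff_mono)
  \<comment> \<open>Two sorted lists with the same multiset coincide, so \<open>q\<close> sends each
    position into its own block.\<close>
  ultimately have "map (\<lambda>j. \<kappa> (q j)) [0..<n] = map \<kappa> [0..<n]"
    by (metis properties_for_sort)
  hence \<kappa>q: "\<kappa> (q j) = \<kappa> j" if "j < n" for j
    using that by simp
  show thesis
  proof (rule that[OF q \<kappa>q])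
    show "B (q j) = B j" if "j < n" for j
      using block that \<kappa>q permutes_less[OF q] by blast
    show "z4_le (v (q i)) (v (q j))" if "i \<le> j" "j < n" "\<kappa> i = \<kappa> j" for i j
    proof -
      have "w (q i) \<le> w (q j)"
        using sorted that by (simp add: sorted_map_iff_mono)
      thus ?thesis
        using \<kappa>q[of i] \<kappa>q[of j] that by (simp add: z4_le_iff w_def)
    qed
  qed
qed

text \<open>Shifting row k and permuting columns inside blocks of the first k rows leave these rows
  untouched, so the new row can be brought into the enumerated form without losing the listed
  part.\<close>

lemma covered_by_row_step:
  assumes "covered_by n k L" "0 < k" "k < n"
    and steps: "\<And>R. R \<in> set L \<Longrightarrow> \<exists>certs. row_step n L' R certs"
  shows "covered_by n (Suc k) L'"
  unfolding covered_by_def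
proof (intro allI impI)
  fix E assume "hadamard n E"
  then obtain F where EF: "equivalent n E F" and R: "row_lists n k F \<in> set L"
    using assms(1) unfolding covered_by_def by blast
  define F' where "F' i j = F i j + (if i = k then - F k 0 else 0)" for i j
  have FF': "equivalent n F F'"
    unfolding F'_def
    by (rule equivalentI[OF permutes_id permutes_id,
          where r = "\<lambda>i. if i = k then - F k 0 else 0" and c = "\<lambda>_. 0"]) simp
  define es where "es = repeated_cols (n - 1) (row_lists n k F)"
  \<comment> \<open>The number of column changes to the left of j, so that \<kappa> numbers the runs
    of equal adjacent columns from left to right.\<close>
  define \<kappa> where "\<kappa> j = card {l. l < j \<and> (\<exists>i<k. F i l \<noteq> F i (Suc l))}" for j
  have fin: "finite {l. l < j \<and> P l}" for j :: nat and P
    by simp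
  have mono: "\<kappa> i \<le> \<kappa> j" if "i \<le> j" for i j
    unfolding \<kappa>_def using that by (intro card_mono fin) auto
  have \<kappa>_Suc: "\<kappa> (Suc j) = \<kappa> j + (if \<exists>i<k. F i j \<noteq> F i (Suc j) then 1 else 0)" for j
  proof -
    have "{l. l < Suc j \<and> (\<exists>i<k. F i l \<noteq> F i (Suc l))} =
        (if \<exists>i<k. F i j \<noteq> F i (Suc j) then insert j else id) {l. l < j \<and> (\<exists>i<k. F i l \<noteq> F i (Suc l))}"
      by (auto simp: less_Suc_eq)
    thus ?thesis
      by (simp add: \<kappa>_def fin)
  qed
  have block: "map (\<lambda>i. F i l) [0..<k] = map (\<lambda>i. F i j) [0..<k]" if "\<kappa> l = \<kappa> j" "l \<le> j" for l j
    using that(2,1)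
  proof (induction j rule: dec_induct)
    case (step j)
    have "\<kappa> l = \<kappa> j" "\<kappa> (Suc j) = \<kappa> j"
      using step mono[of l j] mono[of j "Suc j"] by auto
    thus ?case
      using step.IH \<kappa>_Suc[of j] by (auto split: if_splits)
  qed simp
  obtain q where q: "q permutes {..<n}" and \<kappa>q: "\<And>j. j < n \<Longrightarrow> \<kappa> (q j) = \<kappa> j"
    and B: "\<And>j. j < n \<Longrightarrow> map (\<lambda>i. F i (q j)) [0..<k] = map (\<lambda>i. F i j) [0..<k]"
    and srt: "\<And>i j. i \<le> j \<Longrightarrow> j < n \<Longrightarrow> \<kappa> i = \<kappa> j \<Longrightarrow> z4_le (F' k (q i)) (F' k (q j))"
  proof (rule sort_within_blocks[of n \<kappa> "\<lambda>j. map (\<lambda>i. F i j) [0..<k]" "F' k"])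
    show "map (\<lambda>i. F i l) [0..<k] = map (\<lambda>i. F i j) [0..<k]" if "\<kappa> l = \<kappa> j" for l j
      using block[of l j] block[of j l] that by (cases "l \<le> j") auto
  qed (use mono in blast)+
  define G where "G i j = F' i (q j)" for i j
  have F'G: "equivalent n F' G"
    unfolding G_def
    by (rule equivalentI[OF permutes_id q, where r = "\<lambda>_. 0" and c = "\<lambda>_. 0"]) simp
  have RG: "row_lists n k G = row_lists n k F"
    using B by (intro row_lists_cong) (auto simp: G_def F'_def)
  have EG: "equivalent n E G"
    using EF FF' F'G equivalent_trans by blast
  obtain certs where certs: "row_step n L' (row_lists n k G) certs"
    using steps[OF R] RG by auto
  have "map (G k) [0..<n] \<in> set (candidates n es (row_lists n k G))"
  proof (rule row_in_candidates)
    show "hadamard n G"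
      using EG \<open>hadamard n E\<close> by (rule equivalent_hadamard)
    show "hd (row_lists n k G) = replicate n Z0"
      using certs by (simp add: row_step_def)
    have "F' k 0 = Z0"
      by (simp add: F'_def flip: zero_z4_def)
    \<comment> \<open>Sorting keeps a \<open>Z0\<close> in front: the old column 0 moves to a
      position j of the first block, and the entry now at position 0 is at most the entry
      \<open>Z0\<close> at j.\<close>
    obtain j where j: "j < n" "q j = 0"
      using q assms(3) permutes_less[OF permutes_inv[OF q], of 0] permutes_inverses(1)[OF q, of 0] by fastforce
    have "\<kappa> 0 = \<kappa> j"
      using \<kappa>q[of j] j by simp
    hence "z4_le (F' k (q 0)) (F' k 0)"
      using srt[of 0 j] j by simp
    thus "G k 0 = Z0"
      using \<open>F' k 0 = Z0\<close> by (cases "F' k (q 0)") (auto simp: G_def)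
    show "sorted_on_blocks es (map (G k) [0..<n])"
    proof (subst sorted_on_blocks_iff)
      show "length (map (G k) [0..<n]) = Suc (length es)"
        using assms(3) by (simp add: es_def repeated_cols_def)
      show "\<forall>j<length es. es ! j \<longrightarrow> z4_le (map (G k) [0..<n] ! j) (map (G k) [0..<n] ! Suc j)"
      proof (intro allI impI)
        fix j assume j: "j < length es" "es ! j"
        hence jn: "Suc j < n"
          by (auto simp: es_def repeated_cols_def)
        have "\<forall>i<k. F i j = F i (Suc j)"
          using j jn by (auto simp: es_def repeated_cols_def list_all_iff row_lists_def)
        hence "\<kappa> j = \<kappa> (Suc j)"
          using \<kappa>_Suc[of j] by auto
        thus "z4_le (map (G k) [0..<n] ! j) (map (G k) [0..<n] ! Suc j)"
          using srt[of j "Suc j"] jn by (simp add: G_def)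
      qed
    qed
  qed (use assms in auto)
  then obtain pq where "leads_to n L' (row_lists n k G @ [map (G k) [0..<n]]) pq"
    using certs unfolding row_step_def es_def RG[symmetric] by (blast dest: list_all2_in_set)
  then obtain G' where "equivalent n G G'" "row_lists n (Suc k) G' \<in> set L'"
    using leads_to_sound[of n L' "Suc k" G pq] assms(3) by (auto simp: row_lists_Suc)
  thus "\<exists>F. equivalent n E F \<and> row_lists n (Suc k) F \<in> set L'"
    using EG equivalent_trans by blast
qed

text \<open>Once shifted to start with \<open>Z0\<close>, the missing rows are n - k distinct,
  pairwise orthogonal candidates, hence form one of the enumerated cliques.\<close>

lemma covered_by_completion_step:
  assumes "covered_by n k L" "0 < k" "k \<le> n"
    and steps: "\<And>R. R \<in> set L \<Longrightarrow> \<exists>certs. completion_step n L' R certs"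
  shows "covered_by n n L'"
  unfolding covered_by_def
proof (intro allI impI)
  fix E assume "hadamard n E"
  then obtain F where EF: "equivalent n E F" and R: "row_lists n k F \<in> set L"
    using assms(1) unfolding covered_by_def by blast
  define G where "G i j = F i j + (if k \<le> i then - F i 0 else 0)" for i j
  have "equivalent n F G"
    unfolding G_def
    by (rule equivalentI[OF permutes_id permutes_id,
          where r = "\<lambda>i. if k \<le> i then - F i 0 else 0" and c = "\<lambda>_. 0"]) simp
  hence EG: "equivalent n E G"
    using EF equivalent_trans by blast
  hence G: "hadamard n G"
    using \<open>hadamard n E\<close> by (rule equivalent_hadamard)
  have RG: "row_lists n k G = row_lists n k F"
    by (rule row_lists_cong) (simp add: G_def)
  obtain certs where certs: "completion_step n L' (row_lists n k G) certs"
    using steps[OF R] RG by auto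
  define u where "u i = map (G i) [0..<n]" for i
  have orth: "orth (u i) (u j)" if "i < n" "j < n" "i \<noteq> j" for i j
    unfolding u_def using G that by (rule hadamard_orth)
  \<comment> \<open>A row has inner product n with itself, which is nonzero; orthogonal rows are
    thus distinct and the clique has the full size.\<close>
  have "\<not> orth (u i) (u i)" for i
    using assms(2,3) by (simp add: u_def orth_map_iff)
  hence inj: "inj_on u {..<n}"
    by (intro inj_onI) (metis lessThan_iff orth)
  have "\<exists>xs \<in> set (cliques (n - k) (candidates n [] (row_lists n k G))). set xs = u ` {k..<n}"
  proof (rule cliques_complete)
    show "u ` {k..<n} \<subseteq> set (candidates n [] (row_lists n k G))"
    proof
      fix v assume "v \<in> u ` {k..<n}"
      then obtain i where i: "k \<le> i" "i < n" "v = u i"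
        by auto
      have "G i 0 = Z0"
        using i by (simp add: G_def flip: zero_z4_def)
      thus "v \<in> set (candidates n [] (row_lists n k G))"
        unfolding i(3) u_def
        using G i assms(2) certs by (intro row_in_candidates) (auto simp: completion_step_def)
    qed
    have "inj_on u {k..<n}"
      by (rule inj_on_subset[OF inj]) auto
    thus "card (u ` {k..<n}) = n - k"
      by (simp add: card_image)
  qed (auto intro!: orth)
  then obtain xs where xs: "xs \<in> set (cliques (n - k) (candidates n [] (row_lists n k G)))"
    "set xs = u ` {k..<n}"
    by blast
  obtain pq where pq: "leads_to n L' (row_lists n k G @ xs) pq"
    using certs xs(1) unfolding completion_step_def length_row_lists by (blast dest: list_all2_in_set)
  have row_lists_u: "row_lists n l G = map u [0..<l]" for l
    by (simp add: row_lists_def u_def)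
  \<comment> \<open>The clique holds the missing rows in an order of its own; equality of multisets
    turns the discrepancy into a row permutation.\<close>
  have "mset (row_lists n k G @ xs) = mset (row_lists n n G)"
  proof -
    have "length xs = n - k"
      using xs(1) by (rule length_cliques)
    hence "distinct xs"
      using xs(2) inj by (intro card_distinct) (simp add: card_image inj_on_subset subset_eq)
    moreover have "distinct (map u [k..<n])"
      using inj by (simp add: distinct_map inj_on_subset subset_eq)
    ultimately have "mset xs = mset (map u [k..<n])"
      using xs(2) by (subst set_eq_iff_mset_eq_distinct[symmetric]) auto
    moreover have "row_lists n n G = row_lists n k G @ map u [k..<n]"
      using assms(3) upt_add_eq_append[of 0 k "n - k"] by (simp add: row_lists_u)
    ultimately show ?thesis
      by simp
  qed
  then obtain p where p: "p permutes {..<length (row_lists n n G)}"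
    and eq: "permute_list p (row_lists n n G) = row_lists n k G @ xs"
    by (rule mset_eq_permutation)
  define H where "H i j = G (p i) j" for i j
  have "row_lists n n H = row_lists n k G @ xs"
    using permutes_less[of p n] p unfolding eq[symmetric]
    by (simp add: permute_list_def row_lists_def H_def)
  hence "\<exists>K. equivalent n H K \<and> row_lists n n K \<in> set L'"
    using leads_to_sound[of n L' n H pq] pq assms(2,3) by simp
  moreover have "equivalent n G H"
    unfolding H_def using p
    by (intro equivalentI[OF _ permutes_id, where r = "\<lambda>_. 0" and c = "\<lambda>_. 0"]) auto
  ultimately show "\<exists>K. equivalent n E K \<and> row_lists n n K \<in> set L'"
    using EG equivalent_trans by blast
qed

section \<open>Invariants and the number of classes\<close>

text \<open>Here \<open>orth (vdiff u v) (vdiff w u)\<close> says that \<open>2u - v - w\<close> is balanced.\<close>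

definition triple_count :: "z4 list list \<Rightarrow> nat" where
  "triple_count M =
     (\<Sum>u\<leftarrow>M. \<Sum>v\<leftarrow>M. \<Sum>w\<leftarrow>M. if orth (vdiff u v) (vdiff w u) then 1 else 0)"

definition pair_count :: "z4 list list \<Rightarrow> nat" where
  "pair_count M = (\<Sum>u\<leftarrow>M. \<Sum>v\<leftarrow>M. if orth (vdiff u v) (vdiff v u) then 1 else 0)"

definition columns :: "nat \<Rightarrow> z4 list list \<Rightarrow> z4 list list" where
  "columns n M = map (\<lambda>j. map (\<lambda>r. r ! j) M) [0..<n]"

definition invariant :: "nat \<Rightarrow> z4 list list \<Rightarrow> nat \<times> nat \<times> nat" where
  "invariant n M = (triple_count M, triple_count (columns n M), pair_count M)"

definition valid_matrix :: "nat \<Rightarrow> z4 list list \<Rightarrow> bool" where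
  "valid_matrix n M \<longleftrightarrow> length M = n \<and> list_all (\<lambda>r. length r = n) M \<and> sorted_wrt orth M"

section \<open>Invariance of the counts\<close>

definition triple_indicator :: "nat \<Rightarrow> (nat \<Rightarrow> nat \<Rightarrow> z4) \<Rightarrow> nat \<Rightarrow> nat \<Rightarrow> nat \<Rightarrow> nat" where
  "triple_indicator n E a b c = (if (\<Sum>j<n. iu ((E a j - E b j) - (E c j - E a j))) = 0 then 1 else 0)"

lemma triple_count_row_lists:
  "triple_count (row_lists n n E) = (\<Sum>a<n. \<Sum>b<n. \<Sum>c<n. triple_indicator n E a b c)"
  by (simp add: triple_count_def sum_list_row_lists vdiff_map orth_map_iff triple_indicator_def)

lemma pair_count_row_lists:
  "pair_count (row_lists n n E) = (\<Sum>a<n. \<Sum>b<n. triple_indicator n E a b b)"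
  by (simp add: pair_count_def sum_list_row_lists vdiff_map orth_map_iff triple_indicator_def)

lemma sum_permutes:
  assumes "p permutes {..<n :: nat}"
  shows "(\<Sum>i<n. f (p i)) = (\<Sum>i<n. f i)"
  using sum.permute[OF assms, of f] by (simp add: o_def)

text \<open>In 2 F_a - F_b - F_d the column constants cancel since 2 - 1 - 1 = 0, and the row
  constants form one shift, which does not affect vanishing. Only the row permutation remains
  visible, and sums over all triples or pairs absorb it.\<close>

lemma equivalent_triple_indicator:
  assumes "equivalent n E F"
  obtains p where "p permutes {..<n}"
    and "\<And>a b c. a < n \<Longrightarrow> b < n \<Longrightarrow> c < n \<Longrightarrow>
      triple_indicator n F a b c = triple_indicator n E (p a) (p b) (p c)"
proof -
  obtain p q r c where p: "p permutes {..<n}" and q: "q permutes {..<n}"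
    and F: "\<And>i j. i < n \<Longrightarrow> j < n \<Longrightarrow> F i j = E (p i) (q j) + r i + c j"
    using assms by (rule equivalentE) (rule that)
  show thesis
  proof (rule that[OF p])
    fix a b d assume abd: "a < n" "b < n" "d < n"
    have "(\<Sum>j<n. iu ((F a j - F b j) - (F d j - F a j))) =
        (\<Sum>j<n. iu (((r a - r b) - (r d - r a)) +
          ((E (p a) (q j) - E (p b) (q j)) - (E (p d) (q j) - E (p a) (q j)))))"
      by (intro sum.cong refl arg_cong[where f = iu]) (use abd in \<open>simp add: F algebra_simps\<close>)
    thus "triple_indicator n F a b d = triple_indicator n E (p a) (p b) (p d)"
      using zero_sum_shift_permute[OF q, of _
          "\<lambda>j. (E (p a) j - E (p b) j) - (E (p d) j - E (p a) j)"]
      by (simp add: triple_indicator_def)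
  qed
qed

lemma equivalent_triple_count:
  assumes "equivalent n E F"
  shows "triple_count (row_lists n n F) = triple_count (row_lists n n E)"
proof -
  obtain p where p: "p permutes {..<n}"
    and F: "\<And>a b c. a < n \<Longrightarrow> b < n \<Longrightarrow> c < n \<Longrightarrow>
      triple_indicator n F a b c = triple_indicator n E (p a) (p b) (p c)"
    using assms by (rule equivalent_triple_indicator) (rule that)
  have "(\<Sum>a<n. \<Sum>b<n. \<Sum>c<n. triple_indicator n F a b c) =
      (\<Sum>a<n. \<Sum>b<n. \<Sum>c<n. triple_indicator n E (p a) (p b) (p c))"
    by (intro sum.cong refl) (simp add: F)
  also have "\<dots> = (\<Sum>a<n. \<Sum>b<n. \<Sum>c<n. triple_indicator n E (p a) (p b) c)"
    by (intro sum.cong refl sum_permutes[OF p])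
  also have "\<dots> = (\<Sum>a<n. \<Sum>b<n. \<Sum>c<n. triple_indicator n E (p a) b c)"
    by (intro sum.cong refl sum_permutes[OF p, where f = "\<lambda>b. \<Sum>c<n. triple_indicator n E (p _) b c"])
  also have "\<dots> = (\<Sum>a<n. \<Sum>b<n. \<Sum>c<n. triple_indicator n E a b c)"
    by (rule sum_permutes[OF p, where f = "\<lambda>a. \<Sum>b<n. \<Sum>c<n. triple_indicator n E a b c"])
  finally show ?thesis
    by (simp add: triple_count_row_lists)
qed

lemma equivalent_pair_count:
  assumes "equivalent n E F"
  shows "pair_count (row_lists n n F) = pair_count (row_lists n n E)"
proof -
  obtain p where p: "p permutes {..<n}"
    and F: "\<And>a b c. a < n \<Longrightarrow> b < n \<Longrightarrow> c < n \<Longrightarrow>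
      triple_indicator n F a b c = triple_indicator n E (p a) (p b) (p c)"
    using assms by (rule equivalent_triple_indicator) (rule that)
  have "(\<Sum>a<n. \<Sum>b<n. triple_indicator n F a b b) =
      (\<Sum>a<n. \<Sum>b<n. triple_indicator n E (p a) (p b) (p b))"
    by (intro sum.cong refl) (simp add: F)
  also have "\<dots> = (\<Sum>a<n. \<Sum>b<n. triple_indicator n E (p a) b b)"
    by (intro sum.cong refl sum_permutes[OF p, where f = "\<lambda>b. triple_indicator n E (p _) b b"])
  also have "\<dots> = (\<Sum>a<n. \<Sum>b<n. triple_indicator n E a b b)"
    by (rule sum_permutes[OF p, where f = "\<lambda>a. \<Sum>b<n. triple_indicator n E a b b"])
  finally show ?thesis
    by (simp add: pair_count_row_lists)
qed

lemma columns_row_lists: "columns n (row_lists n n E) = row_lists n n (\<lambda>i j. E j i)"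
  by (simp add: columns_def row_lists_def)

text \<open>Rows and columns play symmetric roles in \<open>equivalent\<close>, so a count for
  columns is an invariant too. It may differ from the count for rows, since a matrix and its
  transpose are not identified.\<close>

lemma equivalent_transpose:
  assumes "equivalent n E F"
  shows "equivalent n (\<lambda>i j. E j i) (\<lambda>i j. F j i)"
proof -
  obtain p q r c where "p permutes {..<n}" "q permutes {..<n}"
    and F: "\<And>i j. i < n \<Longrightarrow> j < n \<Longrightarrow> F i j = E (p i) (q j) + r i + c j"
    using assms by (rule equivalentE) (rule that)
  thus ?thesis
    by (intro equivalentI[of q n p _ _ c r]) (simp_all add: F algebra_simps)
qed

lemma equivalent_invariant:
  assumes "equivalent n E F"
  shows "invariant n (row_lists n n F) = invariant n (row_lists n n E)"
  using assms
  by (simp add: invariant_def columns_row_lists equivalent_triple_count equivalent_pair_count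
      equivalent_transpose)

section \<open>Counting classes by a list of representatives\<close>

lemma row_lists_valid_matrix:
  assumes "valid_matrix n M"
  shows "row_lists n n (\<lambda>i j. M ! i ! j) = M"
proof (rule nth_equalityI)
  fix i assume "i < length (row_lists n n (\<lambda>i j. M ! i ! j))"
  hence "i < n" "length (M ! i) = n"
    using assms by (auto simp: valid_matrix_def list_all_length)
  thus "row_lists n n (\<lambda>i j. M ! i ! j) ! i = M ! i"
    by (auto intro: nth_equalityI)
qed (use assms in \<open>simp add: valid_matrix_def\<close>)

lemma hadamard_valid_matrix:
  assumes "valid_matrix n M"
  shows "hadamard n (\<lambda>i j. M ! i ! j)"
proof -
  define E where "E = (\<lambda>i j. M ! i ! j)"
  have upper: "(\<Sum>j<n. iu (E i j - E k j)) = 0" if "i < k" "k < n" for i k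
  proof -
    have "orth (M ! i) (M ! k)"
      using assms that by (auto simp: valid_matrix_def sorted_wrt_iff_nth_less)
    hence "orth (row_lists n n E ! i) (row_lists n n E ! k)"
      using row_lists_valid_matrix[OF assms] by (simp add: E_def)
    thus ?thesis
      using that by (simp add: orth_map_iff)
  qed
  \<comment> \<open>\<open>sorted_wrt\<close> tests each pair of rows in one order only; the other
    inner product is the complex conjugate.\<close>
  have lower: "(\<Sum>j<n. iu (E k j - E i j)) = 0" if "i < k" "k < n" for i k
  proof -
    have "(\<Sum>j<n. iu (E k j - E i j)) = cnj (\<Sum>j<n. iu (E i j - E k j))"
      by (simp add: iu_diff mult.commute)
    thus ?thesis
      by (simp only: upper[OF that] complex_cnj_zero)
  qed
  have "hadamard n E"
    unfolding hadamard_def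
  proof (intro allI impI)
    fix i k assume "i < n" "k < n" "i \<noteq> k"
    thus "(\<Sum>j<n. iu (E i j - E k j)) = 0"
      using upper[of i k] lower[of k i] by (cases "i < k") auto
  qed
  thus ?thesis
    by (simp add: E_def)
qed

lemma BH_equiv_exp_mat_iff:
  assumes "hadamard n E"
  shows "(exp_mat n E, K) \<in> Restr (Hadamard_equiv n) (BH 4 n) \<longleftrightarrow>
    (\<exists>F. K = exp_mat n F \<and> hadamard n F \<and> equivalent n E F)"
proof
  assume L: "(exp_mat n E, K) \<in> Restr (Hadamard_equiv n) (BH 4 n)"
  then obtain F where "K = exp_mat n F" "hadamard n F"
    using BH_exp_mat by blast
  thus "\<exists>F. K = exp_mat n F \<and> hadamard n F \<and> equivalent n E F"
    using L assms by (auto simp: Hadamard_equiv_exp_mat_iff)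
qed (use assms in \<open>auto simp: Hadamard_equiv_exp_mat_iff exp_mat_in_BH_iff\<close>)

lemma BH_class_eq:
  assumes "hadamard n E" "equivalent n E F"
  shows "Restr (Hadamard_equiv n) (BH 4 n) `` {exp_mat n E} =
    Restr (Hadamard_equiv n) (BH 4 n) `` {exp_mat n F}"
proof -
  have "hadamard n F"
    using assms equivalent_hadamard by blast
  moreover have same: "equivalent n E G \<longleftrightarrow> equivalent n F G" for G
    using assms(2) equivalent_trans equivalent_sym by blast
  ultimately show ?thesis
    using assms(1) by (simp only: set_eq_iff Image_singleton_iff BH_equiv_exp_mat_iff same simp_thms)
qed

text \<open>Mapping a representative to its class is onto by the covering, and injective because two
  members of \<open>L\<close> in one class would share the invariant.\<close>

lemma card_BH_classes:
  assumes cover: "covered_by n n L" and valid: "list_all (valid_matrix n) L"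
    and distinct: "distinct (map (invariant n) L)"
  shows "card (BH_classes 4 n) = length L"
proof -
  define E where "E M = (\<lambda>i j. M ! i ! j)" for M :: "z4 list list"
  define cls where "cls M = Restr (Hadamard_equiv n) (BH 4 n) `` {exp_mat n (E M)}" for M
  have E: "hadamard n (E M)" "row_lists n n (E M) = M" if "M \<in> set L" for M
    using that valid unfolding E_def
    by (auto simp: list_all_iff intro: hadamard_valid_matrix row_lists_valid_matrix)
  have "BH_classes 4 n = cls ` set L"
  proof (intro equalityI subsetI)
    fix X assume "X \<in> BH_classes 4 n"
    then obtain H where "H \<in> BH 4 n" and X: "X = Restr (Hadamard_equiv n) (BH 4 n) `` {H}"
      unfolding BH_classes_def by (blast elim: quotientE)
    then obtain G where G: "H = exp_mat n G" "hadamard n G"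
      using BH_exp_mat by blast
    then obtain F where F: "equivalent n G F" "row_lists n n F \<in> set L"
      using cover unfolding covered_by_def by blast
    \<comment> \<open>The two functions agree on indices below n; values elsewhere are irrelevant to
      \<open>equivalent\<close>.\<close>
    have "equivalent n F (E (row_lists n n F))"
      by (rule equivalent_cong) (simp add: E_def)
    hence "equivalent n G (E (row_lists n n F))"
      using F(1) equivalent_trans by blast
    hence "X = cls (row_lists n n F)"
      unfolding X G(1) cls_def using G(2) by (intro BH_class_eq)
    thus "X \<in> cls ` set L"
      using F(2) by blast
  next
    fix X assume "X \<in> cls ` set L"
    thus "X \<in> BH_classes 4 n"
      using E(1) unfolding BH_classes_def cls_def by (auto intro!: quotientI simp: exp_mat_in_BH_iff)
  qed
  moreover have "inj_on cls (set L)"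
  proof (rule inj_onI)
    fix M N assume MN: "M \<in> set L" "N \<in> set L" "cls M = cls N"
    have "exp_mat n (E N) \<in> cls N"
      unfolding cls_def Image_singleton_iff BH_equiv_exp_mat_iff[OF E(1)[OF MN(2)]]
      using E(1)[OF MN(2)] equivalent_refl by blast
    hence "exp_mat n (E N) \<in> cls M"
      by (simp only: MN(3))
    hence "(exp_mat n (E M), exp_mat n (E N)) \<in> Hadamard_equiv n"
      unfolding cls_def by blast
    hence "equivalent n (E M) (E N)"
      using MN E(1) by (simp add: Hadamard_equiv_exp_mat_iff)
    hence "invariant n M = invariant n N"
      using equivalent_invariant[of n "E M" "E N"] MN E(2) by simp
    thus "M = N"
      using distinct MN by (auto simp: distinct_map dest: inj_onD)
  qed
  ultimately have "card (BH_classes 4 n) = card (set L)"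
    by (simp add: card_image)
  thus ?thesis
    using distinct by (simp add: distinct_map distinct_card)
qed

section \<open>Certificates\<close>

definition BH2_reps :: "z4 list list list" where
  "BH2_reps = [
   [[Z0,Z0], [Z0,Z2]]]"

lemma BH2_reps_completion_step:
  "completion_step 2 BH2_reps
   [replicate 2 Z0] [
    ([0,1],[0,1])]"
  by code_simp

lemma BH2_reps_cover: "covered_by 2 2 BH2_reps"
proof (rule covered_by_completion_step[OF covered_by_zero_row])
  show "\<exists>certs. completion_step 2 BH2_reps R certs" if "R \<in> set [[replicate 2 Z0]]" for R
    using that by (auto intro: BH2_reps_completion_step)
qed simp_all

lemma BH2_reps_valid: "list_all (valid_matrix 2) BH2_reps"
  by code_simp

lemma BH2_reps_inequivalent: "distinct (map (invariant 2) BH2_reps)"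
  by code_simp

section \<open>Order 4: the character tables of Z/2 x Z/2 and of Z/4, up to equivalence\<close>

definition BH4_reps :: "z4 list list list" where
  "BH4_reps = [
   [[Z0,Z0,Z0,Z0], [Z0,Z0,Z2,Z2],
    [Z0,Z2,Z0,Z2], [Z0,Z2,Z2,Z0]],
   [[Z0,Z0,Z0,Z0], [Z0,Z0,Z2,Z2],
    [Z0,Z2,Z1,Z3], [Z0,Z2,Z3,Z1]]]"

lemma BH4_reps_completion_step:
  "completion_step 4 BH4_reps
   [replicate 4 Z0] [
    ([0,3,1,2],[0,2,3,1]), ([0,3,1,2],[0,1,3,2]),
    ([0,3,1,2],[0,3,2,1]), ([0,1,2,3],[0,3,2,1])]"
  by code_simp

lemma BH4_reps_cover: "covered_by 4 4 BH4_reps"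
proof (rule covered_by_completion_step[OF covered_by_zero_row])
  show "\<exists>certs. completion_step 4 BH4_reps R certs" if "R \<in> set [[replicate 4 Z0]]" for R
    using that by (auto intro: BH4_reps_completion_step)
qed simp_all

lemma BH4_reps_valid: "list_all (valid_matrix 4) BH4_reps"
  by code_simp

lemma BH4_reps_inequivalent: "distinct (map (invariant 4) BH4_reps)"
  by code_simp

section \<open>Order 6\<close>

definition BH6_2rows :: "z4 list list list" where
  "BH6_2rows = [
   [[Z0,Z0,Z0,Z0,Z0,Z0], [Z0,Z0,Z0,Z2,Z2,Z2]],
   [[Z0,Z0,Z0,Z0,Z0,Z0], [Z0,Z0,Z1,Z2,Z2,Z3]]]"

text \<open>Below the zero row all columns agree, so a candidate is a sorted word, one for each
  possible number of \<open>Z0\<close>. The first, 0 1 1 2 3 3, becomes the second representative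
  when its leading column is moved to the end and 1 is subtracted.\<close>

lemma BH6_2rows_row_step:
  "row_step 6 BH6_2rows
   [replicate 6 Z0] [
    ([0,1],[1,2,3,4,5,0]), ([0,1],[0,1,2,3,4,5]),
    ([0,1],[0,1,2,3,4,5])]"
  by code_simp

lemma BH6_2rows_cover: "covered_by 6 2 BH6_2rows"
proof -
  have "covered_by 6 (Suc 1) BH6_2rows"
  proof (rule covered_by_row_step[OF covered_by_zero_row])
    show "\<exists>certs. row_step 6 BH6_2rows R certs" if "R \<in> set [[replicate 6 Z0]]" for R
      using that by (auto intro: BH6_2rows_row_step)
  qed simp_all
  thus ?thesis
    by (simp add: numeral_eq_Suc)
qed

definition BH6_reps :: "z4 list list list" where
  "BH6_reps = [
   [[Z0,Z0,Z0,Z0,Z0,Z0], [Z0,Z0,Z1,Z2,Z2,Z3],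
    [Z0,Z1,Z3,Z0,Z2,Z2], [Z0,Z2,Z1,Z3,Z0,Z2],
    [Z0,Z2,Z3,Z2,Z1,Z0], [Z0,Z3,Z2,Z1,Z3,Z1]]]"

text \<open>A dead end: orthogonality to both rows would make the first three entries of a third row
  sum to zero, impossible for an odd number of fourth roots of unity. There is nothing to
  certify.\<close>

lemma BH6_reps_completion_step_1:
  "completion_step 6 BH6_reps
   [[Z0,Z0,Z0,Z0,Z0,Z0], [Z0,Z0,Z0,Z2,Z2,Z2]] []"
  by code_simp

lemma BH6_reps_completion_step_2:
  "completion_step 6 BH6_reps
   [[Z0,Z0,Z0,Z0,Z0,Z0], [Z0,Z0,Z1,Z2,Z2,Z3]] [
    ([0,1,4,5,3,2],[0,1,2,4,3,5]), ([0,1,5,4,3,2],[0,1,2,3,4,5]),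
    ([0,3,5,4,1,2],[0,3,5,4,2,1]), ([0,3,5,4,1,2],[0,4,5,3,2,1])]"
  by code_simp

lemma BH6_reps_cover: "covered_by 6 6 BH6_reps"
proof (rule covered_by_completion_step[OF BH6_2rows_cover])
  show "\<exists>certs. completion_step 6 BH6_reps R certs" if "R \<in> set BH6_2rows" for R
    using that by (auto simp: BH6_2rows_def intro: BH6_reps_completion_step_1 BH6_reps_completion_step_2)
qed simp_all

lemma BH6_reps_valid: "list_all (valid_matrix 6) BH6_reps"
  by code_simp

lemma BH6_reps_inequivalent: "distinct (map (invariant 6) BH6_reps)"
  by code_simp

section \<open>Order 8\<close>

definition BH8_2rows :: "z4 list list list" where
  "BH8_2rows = [
   [[Z0,Z0,Z0,Z0,Z0,Z0,Z0,Z0], [Z0,Z0,Z0,Z0,Z2,Z2,Z2,Z2]],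
   [[Z0,Z0,Z0,Z0,Z0,Z0,Z0,Z0], [Z0,Z0,Z0,Z1,Z2,Z2,Z2,Z3]],
   [[Z0,Z0,Z0,Z0,Z0,Z0,Z0,Z0], [Z0,Z0,Z1,Z1,Z2,Z2,Z3,Z3]]]"

lemma BH8_2rows_row_step:
  "row_step 8 BH8_2rows
   [replicate 8 Z0] [
    ([0,1],[1,2,3,4,5,6,7,0]), ([0,1],[0,1,2,3,4,5,6,7]),
    ([0,1],[0,1,2,3,4,5,6,7]), ([0,1],[0,1,2,3,4,5,6,7])]"
  by code_simp

lemma BH8_2rows_cover: "covered_by 8 2 BH8_2rows"
proof -
  have "covered_by 8 (Suc 1) BH8_2rows"
  proof (rule covered_by_row_step[OF covered_by_zero_row])
    show "\<exists>certs. row_step 8 BH8_2rows R certs" if "R \<in> set [[replicate 8 Z0]]" for R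
      using that by (auto intro: BH8_2rows_row_step)
  qed simp_all
  thus ?thesis
    by (simp add: numeral_eq_Suc)
qed

definition BH8_3rows :: "z4 list list list" where
  "BH8_3rows = [
   [[Z0,Z0,Z0,Z0,Z0,Z0,Z0,Z0], [Z0,Z0,Z0,Z0,Z2,Z2,Z2,Z2],
    [Z0,Z0,Z2,Z2,Z0,Z0,Z2,Z2]],
   [[Z0,Z0,Z0,Z0,Z0,Z0,Z0,Z0], [Z0,Z0,Z0,Z0,Z2,Z2,Z2,Z2],
    [Z0,Z0,Z2,Z2,Z0,Z1,Z2,Z3]],
   [[Z0,Z0,Z0,Z0,Z0,Z0,Z0,Z0], [Z0,Z0,Z0,Z0,Z2,Z2,Z2,Z2],
    [Z0,Z0,Z2,Z2,Z1,Z1,Z3,Z3]],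
   [[Z0,Z0,Z0,Z0,Z0,Z0,Z0,Z0], [Z0,Z0,Z0,Z0,Z2,Z2,Z2,Z2],
    [Z0,Z1,Z2,Z3,Z0,Z1,Z2,Z3]],
   [[Z0,Z0,Z0,Z0,Z0,Z0,Z0,Z0], [Z0,Z0,Z0,Z1,Z2,Z2,Z2,Z3],
    [Z0,Z0,Z2,Z2,Z0,Z1,Z3,Z2]],
   [[Z0,Z0,Z0,Z0,Z0,Z0,Z0,Z0], [Z0,Z0,Z0,Z1,Z2,Z2,Z2,Z3],
    [Z0,Z1,Z2,Z0,Z0,Z2,Z3,Z2]],
   [[Z0,Z0,Z0,Z0,Z0,Z0,Z0,Z0], [Z0,Z0,Z1,Z1,Z2,Z2,Z3,Z3],
    [Z0,Z0,Z2,Z3,Z1,Z3,Z1,Z2]],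
   [[Z0,Z0,Z0,Z0,Z0,Z0,Z0,Z0], [Z0,Z0,Z1,Z1,Z2,Z2,Z3,Z3],
    [Z0,Z1,Z0,Z3,Z2,Z3,Z1,Z2]]]"

lemma BH8_3rows_row_step_1:
  "row_step 8 BH8_3rows
   [[Z0,Z0,Z0,Z0,Z0,Z0,Z0,Z0], [Z0,Z0,Z0,Z0,Z2,Z2,Z2,Z2]] [
    ([0,1,2],[4,5,6,7,1,2,3,0]), ([0,1,2],[0,1,2,3,4,5,6,7]),
    ([0,1,2],[0,1,2,3,4,5,6,7]), ([0,1,2],[4,5,6,7,0,1,2,3]),
    ([0,1,2],[0,1,2,3,4,5,6,7]), ([0,1,2],[0,1,2,3,4,5,6,7])]"
  by code_simp

text \<open>A row permutation not beginning with 0 normalizes with respect to another row, so a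
  triple of rows may reappear above a different second row, for instance one belonging to the first
  two-row matrix.\<close>

lemma BH8_3rows_row_step_2:
  "row_step 8 BH8_3rows
   [[Z0,Z0,Z0,Z0,Z0,Z0,Z0,Z0], [Z0,Z0,Z0,Z1,Z2,Z2,Z2,Z3]] [
    ([0,1,2],[2,0,1,3,6,4,5,7]), ([0,1,2],[5,6,4,7,2,0,1,3]),
    ([0,1,2],[4,5,6,7,1,2,0,3]), ([1,0,2],[4,5,6,3,2,0,1,7]),
    ([1,0,2],[5,6,4,3,0,1,2,7]), ([1,0,2],[1,2,0,7,4,5,6,3]),
    ([1,0,2],[0,1,2,7,5,6,4,3]), ([1,0,2],[2,0,1,7,5,6,4,3]),
    ([1,0,2],[5,6,4,3,1,2,0,7]), ([1,0,2],[0,1,2,7,6,4,5,3]),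
    ([1,0,2],[1,2,0,7,4,5,6,3]), ([0,1,2],[1,2,0,3,6,4,5,7]),
    ([0,1,2],[1,2,0,3,5,6,4,7]), ([1,2,0],[0,1,5,6,2,7,4,3]),
    ([0,1,2],[4,5,6,7,0,1,2,3]), ([0,1,2],[0,1,2,3,4,5,6,7]),
    ([0,1,2],[0,1,2,3,4,5,6,7]), ([1,2,0],[1,2,4,5,0,7,6,3]),
    ([0,2,1],[1,2,5,6,0,3,4,7]), ([0,2,1],[0,1,4,5,2,3,6,7])]"
  by code_simp

lemma BH8_3rows_row_step_3:
  "row_step 8 BH8_3rows
   [[Z0,Z0,Z0,Z0,Z0,Z0,Z0,Z0], [Z0,Z0,Z1,Z1,Z2,Z2,Z3,Z3]] [
    ([2,0,1],[6,7,2,0,3,5,1,4]), ([2,0,1],[2,3,7,5,6,1,4,0]),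
    ([2,0,1],[2,4,6,0,7,3,5,1]), ([0,1,2],[1,0,3,2,4,5,6,7]),
    ([1,2,0],[0,1,4,5,6,7,2,3]), ([0,1,2],[6,7,1,0,3,2,4,5]),
    ([0,1,2],[2,3,4,5,6,7,0,1]), ([2,0,1],[2,4,0,6,3,5,7,1]),
    ([1,0,2],[1,0,7,6,5,4,2,3]), ([0,1,2],[0,1,2,3,4,5,6,7]),
    ([0,1,2],[0,1,2,3,4,5,6,7]), ([0,1,2],[4,5,6,7,0,1,2,3]),
    ([0,1,2],[6,7,0,1,3,2,5,4]), ([0,1,2],[4,5,7,6,1,0,2,3]),
    ([0,1,2],[2,3,4,5,7,6,1,0]), ([1,2,0],[0,7,5,2,1,6,4,3]),
    ([2,0,1],[0,2,7,5,1,3,4,6]), ([1,0,2],[0,1,7,6,4,5,2,3]),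
    ([2,0,1],[4,5,1,7,0,2,6,3]), ([2,0,1],[2,3,7,5,6,0,4,1]),
    ([2,0,1],[4,6,0,3,1,5,7,2]), ([2,0,1],[6,0,2,5,3,7,1,4]),
    ([2,0,1],[0,1,4,3,5,7,2,6]), ([2,0,1],[6,7,3,1,2,4,0,5]),
    ([2,0,1],[0,2,4,7,5,1,3,6]), ([2,0,1],[4,5,0,7,1,3,6,2]),
    ([0,2,1],[0,2,4,6,1,3,5,7]), ([0,2,1],[0,1,4,5,2,3,6,7])]"
  by code_simp

lemma BH8_3rows_cover: "covered_by 8 3 BH8_3rows"
proof -
  have "covered_by 8 (Suc 2) BH8_3rows"
  proof (rule covered_by_row_step[OF BH8_2rows_cover])
    show "\<exists>certs. row_step 8 BH8_3rows R certs" if "R \<in> set BH8_2rows" for R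
      using that by (auto simp: BH8_2rows_def intro: BH8_3rows_row_step_1 BH8_3rows_row_step_2 BH8_3rows_row_step_3)
  qed simp_all
  thus ?thesis
    by (simp add: numeral_eq_Suc)
qed

text \<open>The first matrix is the real one. Grouped by their first three rows, the representatives
  continue the first five matrices of \<open>BH8_3rows\<close>, in numbers 7, 4, 2, 1, 1; the other
  three partial matrices complete only to matrices equivalent to these.\<close>

definition BH8_reps :: "z4 list list list" where
  "BH8_reps = [
   [[Z0,Z0,Z0,Z0,Z0,Z0,Z0,Z0], [Z0,Z0,Z0,Z0,Z2,Z2,Z2,Z2],
    [Z0,Z0,Z2,Z2,Z0,Z0,Z2,Z2], [Z0,Z0,Z2,Z2,Z2,Z2,Z0,Z0],
    [Z0,Z2,Z0,Z2,Z0,Z2,Z0,Z2], [Z0,Z2,Z0,Z2,Z2,Z0,Z2,Z0],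
    [Z0,Z2,Z2,Z0,Z0,Z2,Z2,Z0], [Z0,Z2,Z2,Z0,Z2,Z0,Z0,Z2]],
   [[Z0,Z0,Z0,Z0,Z0,Z0,Z0,Z0], [Z0,Z0,Z0,Z0,Z2,Z2,Z2,Z2],
    [Z0,Z0,Z2,Z2,Z0,Z0,Z2,Z2], [Z0,Z0,Z2,Z2,Z2,Z2,Z0,Z0],
    [Z0,Z2,Z0,Z2,Z0,Z2,Z0,Z2], [Z0,Z2,Z0,Z2,Z2,Z0,Z2,Z0],
    [Z0,Z2,Z2,Z0,Z1,Z3,Z3,Z1], [Z0,Z2,Z2,Z0,Z3,Z1,Z1,Z3]],
   [[Z0,Z0,Z0,Z0,Z0,Z0,Z0,Z0], [Z0,Z0,Z0,Z0,Z2,Z2,Z2,Z2],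
    [Z0,Z0,Z2,Z2,Z0,Z0,Z2,Z2], [Z0,Z0,Z2,Z2,Z2,Z2,Z0,Z0],
    [Z0,Z2,Z0,Z2,Z0,Z2,Z1,Z3], [Z0,Z2,Z0,Z2,Z2,Z0,Z3,Z1],
    [Z0,Z2,Z2,Z0,Z0,Z2,Z3,Z1], [Z0,Z2,Z2,Z0,Z2,Z0,Z1,Z3]],
   [[Z0,Z0,Z0,Z0,Z0,Z0,Z0,Z0], [Z0,Z0,Z0,Z0,Z2,Z2,Z2,Z2],
    [Z0,Z0,Z2,Z2,Z0,Z0,Z2,Z2], [Z0,Z0,Z2,Z2,Z2,Z2,Z0,Z0],
    [Z0,Z2,Z0,Z2,Z0,Z2,Z1,Z3], [Z0,Z2,Z0,Z2,Z2,Z0,Z3,Z1],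
    [Z0,Z2,Z2,Z0,Z1,Z3,Z0,Z2], [Z0,Z2,Z2,Z0,Z3,Z1,Z2,Z0]],
   [[Z0,Z0,Z0,Z0,Z0,Z0,Z0,Z0], [Z0,Z0,Z0,Z0,Z2,Z2,Z2,Z2],
    [Z0,Z0,Z2,Z2,Z0,Z0,Z2,Z2], [Z0,Z0,Z2,Z2,Z2,Z2,Z0,Z0],
    [Z0,Z2,Z0,Z2,Z1,Z3,Z1,Z3], [Z0,Z2,Z0,Z2,Z3,Z1,Z3,Z1],
    [Z0,Z2,Z2,Z0,Z1,Z3,Z3,Z1], [Z0,Z2,Z2,Z0,Z3,Z1,Z1,Z3]],
   [[Z0,Z0,Z0,Z0,Z0,Z0,Z0,Z0], [Z0,Z0,Z0,Z0,Z2,Z2,Z2,Z2],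
    [Z0,Z0,Z2,Z2,Z0,Z0,Z2,Z2], [Z0,Z0,Z2,Z2,Z2,Z2,Z0,Z0],
    [Z0,Z2,Z0,Z2,Z1,Z3,Z1,Z3], [Z0,Z2,Z1,Z3,Z0,Z2,Z3,Z1],
    [Z0,Z2,Z2,Z0,Z3,Z1,Z1,Z3], [Z0,Z2,Z3,Z1,Z2,Z0,Z3,Z1]],
   [[Z0,Z0,Z0,Z0,Z0,Z0,Z0,Z0], [Z0,Z0,Z0,Z0,Z2,Z2,Z2,Z2],
    [Z0,Z0,Z2,Z2,Z0,Z0,Z2,Z2], [Z0,Z1,Z2,Z3,Z2,Z3,Z0,Z1],
    [Z0,Z2,Z0,Z2,Z0,Z2,Z0,Z2], [Z0,Z2,Z1,Z3,Z3,Z1,Z2,Z0],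
    [Z0,Z2,Z3,Z1,Z1,Z3,Z2,Z0], [Z0,Z3,Z2,Z1,Z2,Z1,Z0,Z3]],
   [[Z0,Z0,Z0,Z0,Z0,Z0,Z0,Z0], [Z0,Z0,Z0,Z0,Z2,Z2,Z2,Z2],
    [Z0,Z0,Z2,Z2,Z0,Z1,Z2,Z3], [Z0,Z0,Z2,Z2,Z2,Z3,Z0,Z1],
    [Z0,Z2,Z0,Z2,Z1,Z0,Z3,Z2], [Z0,Z2,Z0,Z2,Z3,Z2,Z1,Z0],
    [Z0,Z2,Z2,Z0,Z1,Z3,Z1,Z3], [Z0,Z2,Z2,Z0,Z3,Z1,Z3,Z1]],
   [[Z0,Z0,Z0,Z0,Z0,Z0,Z0,Z0], [Z0,Z0,Z0,Z0,Z2,Z2,Z2,Z2],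
    [Z0,Z0,Z2,Z2,Z0,Z1,Z2,Z3], [Z0,Z0,Z2,Z2,Z2,Z3,Z0,Z1],
    [Z0,Z2,Z1,Z3,Z0,Z2,Z0,Z2], [Z0,Z2,Z1,Z3,Z2,Z0,Z2,Z0],
    [Z0,Z2,Z3,Z1,Z0,Z3,Z2,Z1], [Z0,Z2,Z3,Z1,Z2,Z1,Z0,Z3]],
   [[Z0,Z0,Z0,Z0,Z0,Z0,Z0,Z0], [Z0,Z0,Z0,Z0,Z2,Z2,Z2,Z2],
    [Z0,Z0,Z2,Z2,Z0,Z1,Z2,Z3], [Z0,Z0,Z2,Z2,Z2,Z3,Z0,Z1],
    [Z0,Z2,Z1,Z3,Z0,Z2,Z0,Z2], [Z0,Z2,Z1,Z3,Z2,Z0,Z2,Z0],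
    [Z0,Z2,Z3,Z1,Z1,Z0,Z3,Z2], [Z0,Z2,Z3,Z1,Z3,Z2,Z1,Z0]],
   [[Z0,Z0,Z0,Z0,Z0,Z0,Z0,Z0], [Z0,Z0,Z0,Z0,Z2,Z2,Z2,Z2],
    [Z0,Z0,Z2,Z2,Z0,Z1,Z2,Z3], [Z0,Z1,Z2,Z3,Z2,Z0,Z0,Z2],
    [Z0,Z2,Z0,Z2,Z1,Z3,Z1,Z3], [Z0,Z2,Z0,Z2,Z3,Z1,Z3,Z1],
    [Z0,Z2,Z2,Z0,Z0,Z3,Z2,Z1], [Z0,Z3,Z2,Z1,Z2,Z2,Z0,Z0]],
   [[Z0,Z0,Z0,Z0,Z0,Z0,Z0,Z0], [Z0,Z0,Z0,Z0,Z2,Z2,Z2,Z2],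
    [Z0,Z0,Z2,Z2,Z1,Z1,Z3,Z3], [Z0,Z0,Z2,Z2,Z3,Z3,Z1,Z1],
    [Z0,Z2,Z1,Z3,Z0,Z2,Z1,Z3], [Z0,Z2,Z1,Z3,Z2,Z0,Z3,Z1],
    [Z0,Z2,Z3,Z1,Z1,Z3,Z0,Z2], [Z0,Z2,Z3,Z1,Z3,Z1,Z2,Z0]],
   [[Z0,Z0,Z0,Z0,Z0,Z0,Z0,Z0], [Z0,Z0,Z0,Z0,Z2,Z2,Z2,Z2],
    [Z0,Z0,Z2,Z2,Z1,Z1,Z3,Z3], [Z0,Z1,Z2,Z3,Z0,Z3,Z1,Z2],
    [Z0,Z2,Z0,Z2,Z1,Z3,Z3,Z1], [Z0,Z2,Z1,Z3,Z3,Z1,Z2,Z0],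
    [Z0,Z2,Z3,Z1,Z3,Z1,Z0,Z2], [Z0,Z3,Z2,Z1,Z2,Z3,Z1,Z0]],
   [[Z0,Z0,Z0,Z0,Z0,Z0,Z0,Z0], [Z0,Z0,Z0,Z0,Z2,Z2,Z2,Z2],
    [Z0,Z1,Z2,Z3,Z0,Z1,Z2,Z3], [Z0,Z1,Z3,Z2,Z1,Z3,Z0,Z2],
    [Z0,Z2,Z1,Z3,Z3,Z2,Z0,Z1], [Z0,Z2,Z3,Z1,Z3,Z0,Z2,Z1],
    [Z0,Z3,Z1,Z2,Z1,Z3,Z2,Z0], [Z0,Z3,Z2,Z1,Z2,Z1,Z0,Z3]],
   [[Z0,Z0,Z0,Z0,Z0,Z0,Z0,Z0], [Z0,Z0,Z0,Z1,Z2,Z2,Z2,Z3],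
    [Z0,Z0,Z2,Z2,Z0,Z1,Z3,Z2], [Z0,Z0,Z2,Z3,Z2,Z3,Z1,Z1],
    [Z0,Z2,Z1,Z0,Z1,Z3,Z3,Z2], [Z0,Z2,Z1,Z3,Z3,Z1,Z1,Z3],
    [Z0,Z2,Z3,Z1,Z3,Z2,Z0,Z1], [Z0,Z2,Z3,Z2,Z1,Z0,Z2,Z0]]]"

lemma BH8_reps_completion_step_1:
  "completion_step 8 BH8_reps
   [[Z0,Z0,Z0,Z0,Z0,Z0,Z0,Z0], [Z0,Z0,Z0,Z0,Z2,Z2,Z2,Z2],
    [Z0,Z0,Z2,Z2,Z0,Z0,Z2,Z2]] [
    ([0,2,7,1,3,5,4,6],[2,3,6,7,4,5,0,1]), ([0,7,1,2,5,6,3,4],[2,3,5,4,0,1,6,7]),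
    ([0,2,1,7,5,6,3,4],[2,3,7,6,0,1,4,5]), ([0,1,2,7,5,6,3,4],[4,5,7,6,0,1,2,3]),
    ([0,2,7,1,3,5,4,6],[2,3,7,6,5,4,1,0]), ([0,7,1,2,5,6,3,4],[2,3,4,5,1,0,7,6]),
    ([0,2,1,7,5,6,3,4],[2,3,6,7,1,0,5,4]), ([0,1,2,7,5,6,3,4],[4,5,7,6,0,1,3,2]),
    ([0,1,2,7,5,6,3,4],[4,5,6,7,1,0,3,2]), ([0,2,1,7,5,6,3,4],[2,3,7,6,0,1,5,4]),
    ([0,1,2,7,5,6,3,4],[4,5,6,7,1,0,2,3]), ([0,2,1,7,5,6,3,4],[2,3,6,7,1,0,4,5]),
    ([0,7,1,2,5,6,3,4],[2,3,5,4,0,1,7,6]), ([0,7,1,2,5,6,3,4],[2,3,4,5,1,0,6,7]),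
    ([0,1,7,5,2,3,4,6],[0,3,1,2,4,6,5,7]), ([0,2,7,5,1,3,4,6],[0,5,1,4,2,6,3,7]),
    ([0,1,2,3,7,6,5,4],[0,1,3,2,5,4,7,6]), ([0,5,1,7,2,6,3,4],[0,3,5,7,1,2,4,6]),
    ([0,1,7,5,2,3,4,6],[0,2,1,3,4,6,5,7]), ([0,2,7,5,1,3,4,6],[0,5,1,4,3,6,2,7]),
    ([0,1,2,3,7,6,5,4],[0,1,2,3,5,4,7,6]), ([0,5,1,7,2,6,3,4],[0,2,5,7,1,3,4,6]),
    ([0,1,7,5,2,3,4,6],[0,3,1,2,5,6,4,7]), ([0,2,7,5,1,3,4,6],[0,4,1,5,2,6,3,7]),
    ([0,1,2,3,7,5,6,4],[0,1,3,2,4,5,7,6]), ([0,5,1,6,2,7,3,4],[0,3,4,7,1,2,5,6]),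
    ([0,1,7,5,2,3,4,6],[0,2,1,3,5,6,4,7]), ([0,2,7,5,1,3,4,6],[0,4,1,5,3,6,2,7]),
    ([0,1,2,3,7,5,6,4],[0,1,2,3,4,5,7,6]), ([0,5,1,6,2,7,3,4],[0,2,4,7,1,3,5,6]),
    ([0,1,2,5,7,4,3,6],[0,1,2,3,5,4,6,7]), ([0,1,2,5,7,3,4,6],[0,1,3,2,4,5,6,7]),
    ([0,7,1,2,3,4,6,5],[0,1,7,6,3,2,5,4]), ([0,5,1,2,6,7,4,3],[0,1,6,7,2,3,5,4]),
    ([0,2,7,1,4,3,6,5],[0,1,5,4,7,6,2,3]), ([0,1,7,2,4,3,6,5],[0,1,3,2,7,6,4,5]),
    ([0,1,2,5,7,4,3,6],[0,1,3,2,5,4,6,7]), ([0,1,2,5,7,3,4,6],[0,1,2,3,4,5,6,7]),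
    ([0,7,1,2,3,4,6,5],[0,1,7,6,2,3,5,4]), ([0,5,1,2,6,7,4,3],[0,1,6,7,3,2,5,4]),
    ([0,2,7,1,4,3,6,5],[0,1,5,4,7,6,3,2]), ([0,1,7,2,4,3,6,5],[0,1,2,3,7,6,4,5]),
    ([0,1,7,2,4,3,6,5],[0,1,3,2,7,6,5,4]), ([0,2,7,1,4,3,6,5],[0,1,4,5,7,6,2,3]),
    ([0,1,7,2,4,3,6,5],[0,1,2,3,7,6,5,4]), ([0,2,7,1,4,3,6,5],[0,1,4,5,7,6,3,2]),
    ([0,1,7,6,2,3,5,4],[0,3,1,2,4,7,5,6]), ([0,2,7,6,1,3,5,4],[0,5,1,4,2,7,3,6]),
    ([0,7,1,6,2,5,3,4],[0,3,5,6,1,2,4,7]), ([0,1,7,6,2,3,5,4],[0,2,1,3,4,7,5,6]),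
    ([0,2,7,6,1,3,5,4],[0,5,1,4,3,7,2,6]), ([0,7,1,6,2,5,3,4],[0,2,5,6,1,3,4,7]),
    ([0,2,7,6,1,3,5,4],[0,4,1,5,2,7,3,6]), ([0,1,7,6,2,3,5,4],[0,3,1,2,5,7,4,6]),
    ([0,7,1,5,2,6,3,4],[0,3,4,6,1,2,5,7]), ([0,2,7,6,1,3,5,4],[0,4,1,5,3,7,2,6]),
    ([0,1,7,6,2,3,5,4],[0,2,1,3,5,7,4,6]), ([0,7,1,5,2,6,3,4],[0,2,4,6,1,3,5,7]),
    ([0,2,1,7,3,5,6,4],[0,1,5,4,3,2,7,6]), ([0,1,2,7,5,3,6,4],[0,1,3,2,5,4,6,7]),
    ([0,2,1,5,6,7,4,3],[0,1,4,5,2,3,7,6]), ([0,2,1,7,3,5,6,4],[0,1,5,4,2,3,7,6]),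
    ([0,1,2,7,5,3,6,4],[0,1,2,3,5,4,6,7]), ([0,2,1,5,6,7,4,3],[0,1,4,5,3,2,7,6]),
    ([0,1,2,7,3,5,4,6],[0,1,3,2,5,4,7,6]), ([0,1,2,7,3,6,5,4],[0,1,3,2,5,4,7,6]),
    ([0,1,2,5,6,7,4,3],[0,1,2,3,4,5,7,6]), ([0,1,2,7,3,5,4,6],[0,1,2,3,5,4,7,6]),
    ([0,1,2,7,3,6,5,4],[0,1,2,3,5,4,7,6]), ([0,1,2,5,6,7,4,3],[0,1,3,2,4,5,7,6]),
    ([0,2,1,5,6,7,4,3],[0,1,5,4,2,3,7,6]), ([0,2,1,5,6,7,4,3],[0,1,5,4,3,2,7,6]),
    ([0,1,2,5,6,7,4,3],[0,1,2,3,5,4,7,6]), ([0,1,2,5,6,7,4,3],[0,1,3,2,5,4,7,6]),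
    ([0,5,1,2,6,7,4,3],[0,1,7,6,2,3,5,4]), ([0,5,1,2,6,7,4,3],[0,1,7,6,3,2,5,4]),
    ([0,2,7,1,3,5,4,6],[0,1,5,4,7,6,3,2]), ([0,7,1,2,5,6,3,4],[0,1,6,7,3,2,5,4]),
    ([0,2,1,7,4,6,3,5],[0,1,4,5,3,2,7,6]), ([0,2,7,1,3,5,4,6],[0,1,5,4,7,6,2,3]),
    ([0,7,1,2,5,6,3,4],[0,1,6,7,2,3,5,4]), ([0,2,1,7,4,6,3,5],[0,1,4,5,2,3,7,6]),
    ([0,7,1,2,3,4,5,6],[0,1,7,6,3,2,5,4]), ([0,1,7,2,3,6,4,5],[0,1,3,2,7,6,5,4]),
    ([0,1,2,7,4,6,3,5],[0,1,2,3,5,4,7,6]), ([0,7,1,2,3,4,5,6],[0,1,7,6,2,3,5,4]),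
    ([0,1,7,2,3,6,4,5],[0,1,2,3,7,6,5,4]), ([0,1,2,7,4,6,3,5],[0,1,3,2,5,4,7,6]),
    ([0,2,1,7,4,6,3,5],[0,1,5,4,3,2,7,6]), ([0,2,1,7,4,6,3,5],[0,1,5,4,2,3,7,6]),
    ([0,1,2,7,4,6,3,5],[0,1,2,3,4,5,7,6]), ([0,1,2,7,4,6,3,5],[0,1,3,2,4,5,7,6]),
    ([0,1,2,7,3,6,5,4],[0,1,3,2,5,4,7,6]), ([0,1,2,7,3,6,5,4],[0,1,2,3,5,4,7,6]),
    ([0,1,2,3,4,7,6,5],[0,1,3,2,5,4,7,6]), ([0,1,2,3,4,7,6,5],[0,1,2,3,5,4,7,6])]"
  by code_simp

lemma BH8_reps_completion_step_2:
  "completion_step 8 BH8_reps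
   [[Z0,Z0,Z0,Z0,Z0,Z0,Z0,Z0], [Z0,Z0,Z0,Z0,Z2,Z2,Z2,Z2],
    [Z0,Z0,Z2,Z2,Z0,Z1,Z2,Z3]] [
    ([0,1,2,4,5,6,7,3],[1,0,2,3,4,5,6,7]), ([0,6,1,7,2,5,4,3],[1,2,4,6,0,3,5,7]),
    ([0,1,2,4,5,6,7,3],[1,0,3,2,4,5,6,7]), ([0,6,1,7,2,5,4,3],[1,3,4,6,0,2,5,7]),
    ([0,1,2,7,3,4,5,6],[2,3,0,1,6,7,4,5]), ([0,1,2,7,3,4,5,6],[2,3,0,1,6,7,4,5]),
    ([0,1,2,7,4,3,6,5],[2,3,1,0,6,7,4,5]), ([0,1,2,7,4,3,6,5],[2,3,1,0,6,7,4,5]),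
    ([0,1,2,6,7,5,4,3],[0,1,2,3,4,5,6,7]), ([0,1,2,6,7,5,4,3],[0,1,3,2,4,5,6,7]),
    ([0,1,2,6,7,5,3,4],[0,1,2,3,4,5,6,7]), ([0,1,2,6,7,5,3,4],[0,1,3,2,4,5,6,7]),
    ([0,1,2,7,4,3,6,5],[0,1,3,2,4,5,6,7]), ([0,1,2,6,7,5,4,3],[0,1,2,3,4,5,6,7]),
    ([2,5,6,7,0,1,4,3],[0,3,1,2,4,6,7,5]), ([0,1,2,7,4,3,6,5],[0,1,2,3,4,5,6,7]),
    ([0,1,2,6,7,5,4,3],[0,1,3,2,4,5,6,7]), ([2,5,6,7,0,1,4,3],[0,2,1,3,4,6,7,5]),
    ([0,7,1,6,2,4,5,3],[0,2,4,6,1,3,5,7]), ([0,7,1,6,2,4,5,3],[0,3,4,6,1,2,5,7]),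
    ([0,1,6,7,3,5,4,2],[0,2,3,1,7,5,6,4]), ([0,1,6,7,3,5,4,2],[0,3,2,1,7,5,6,4]),
    ([0,1,7,6,2,3,4,5],[0,2,1,3,4,6,5,7]), ([0,1,7,6,2,3,4,5],[0,3,1,2,4,6,5,7])]"
  by code_simp

lemma BH8_reps_completion_step_3:
  "completion_step 8 BH8_reps
   [[Z0,Z0,Z0,Z0,Z0,Z0,Z0,Z0], [Z0,Z0,Z0,Z0,Z2,Z2,Z2,Z2],
    [Z0,Z0,Z2,Z2,Z1,Z1,Z3,Z3]] [
    ([3,6,4,5,0,1,2,7],[4,5,6,7,2,3,1,0]), ([0,1,6,3,5,2,7,4],[2,0,3,1,5,6,4,7]),
    ([0,1,6,3,2,5,7,4],[2,0,3,1,7,4,6,5]), ([0,1,3,4,6,7,2,5],[4,6,7,5,2,0,3,1]),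
    ([3,6,4,5,0,1,2,7],[4,5,6,7,3,2,1,0]), ([0,1,6,3,5,2,7,4],[2,1,3,0,4,7,5,6]),
    ([0,1,6,3,2,5,7,4],[2,1,3,0,6,5,7,4]), ([0,1,3,4,6,7,2,5],[4,6,7,5,3,0,2,1]),
    ([0,1,3,4,6,7,2,5],[4,7,6,5,3,1,2,0]), ([0,1,6,3,2,5,7,4],[2,0,3,1,7,5,6,4]),
    ([0,1,3,4,6,7,2,5],[4,7,6,5,2,1,3,0]), ([0,1,6,3,2,5,7,4],[2,1,3,0,6,4,7,5]),
    ([0,1,6,3,5,2,7,4],[2,0,3,1,5,7,4,6]), ([0,1,6,3,5,2,7,4],[2,1,3,0,4,6,5,7]),
    ([0,1,2,7,5,4,6,3],[0,1,2,3,5,4,6,7]), ([0,1,7,5,2,6,3,4],[0,2,1,3,4,6,7,5]),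
    ([2,4,7,6,5,0,1,3],[0,3,6,5,4,7,2,1]), ([0,1,6,7,2,5,4,3],[0,2,1,3,5,7,4,6]),
    ([0,1,2,7,5,4,6,3],[0,1,3,2,5,4,6,7]), ([0,1,7,5,2,6,3,4],[0,3,1,2,4,6,7,5]),
    ([2,4,7,6,5,0,1,3],[0,2,6,5,4,7,3,1]), ([0,1,6,7,2,5,4,3],[0,3,1,2,5,7,4,6]),
    ([0,1,2,7,5,4,6,3],[0,1,2,3,4,5,6,7]), ([0,1,7,4,2,6,3,5],[0,2,1,3,5,6,7,4]),
    ([2,5,7,6,4,0,1,3],[0,3,6,4,5,7,2,1]), ([0,1,6,7,2,5,4,3],[0,2,1,3,4,7,5,6]),
    ([0,1,2,7,5,4,6,3],[0,1,3,2,4,5,6,7]), ([0,1,7,4,2,6,3,5],[0,3,1,2,5,6,7,4]),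
    ([2,5,7,6,4,0,1,3],[0,2,6,4,5,7,3,1]), ([0,1,6,7,2,5,4,3],[0,3,1,2,4,7,5,6]),
    ([3,4,6,7,0,5,1,2],[0,1,7,6,4,5,2,3]), ([0,6,7,5,1,4,3,2],[0,6,2,5,3,4,1,7]),
    ([0,1,2,5,7,6,3,4],[0,1,2,3,4,5,7,6]), ([0,1,2,4,5,7,3,6],[0,1,2,3,5,4,7,6]),
    ([2,5,7,1,4,3,6,0],[0,4,2,6,3,7,1,5]), ([3,4,6,7,0,5,1,2],[0,1,7,6,4,5,3,2]),
    ([0,6,7,5,1,4,3,2],[0,6,3,5,2,4,1,7]), ([0,1,2,5,7,6,3,4],[0,1,3,2,4,5,7,6]),
    ([0,1,2,4,5,7,3,6],[0,1,3,2,5,4,7,6]), ([2,5,7,1,4,3,6,0],[0,4,3,6,2,7,1,5]),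
    ([0,1,2,5,7,6,3,4],[0,1,2,3,5,4,7,6]), ([2,5,7,1,4,3,6,0],[0,5,2,6,3,7,1,4]),
    ([0,1,2,4,5,7,3,6],[0,1,2,3,4,5,7,6]), ([0,1,2,5,7,6,3,4],[0,1,3,2,5,4,7,6]),
    ([2,5,7,1,4,3,6,0],[0,5,3,6,2,7,1,4]), ([0,1,2,4,5,7,3,6],[0,1,3,2,4,5,7,6]),
    ([0,1,5,7,2,4,3,6],[0,2,1,3,4,7,6,5]), ([2,5,6,4,7,1,0,3],[0,3,4,6,7,5,2,1]),
    ([0,1,7,6,2,4,5,3],[0,2,1,3,5,6,4,7]), ([0,1,5,7,2,4,3,6],[0,3,1,2,4,7,6,5]),
    ([2,5,6,4,7,1,0,3],[0,2,4,6,7,5,3,1]), ([0,1,7,6,2,4,5,3],[0,3,1,2,5,6,4,7]),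
    ([0,1,5,6,2,4,3,7],[0,2,1,3,5,7,6,4]), ([2,5,7,4,6,1,0,3],[0,3,5,6,7,4,2,1]),
    ([0,1,7,6,2,4,5,3],[0,2,1,3,4,6,5,7]), ([0,1,5,6,2,4,3,7],[0,3,1,2,5,7,6,4]),
    ([2,5,7,4,6,1,0,3],[0,2,5,6,7,4,3,1]), ([0,1,7,6,2,4,5,3],[0,3,1,2,4,6,5,7]),
    ([4,5,6,7,2,0,3,1],[0,1,6,7,5,4,3,2]), ([2,6,7,0,3,4,5,1],[0,7,2,5,3,4,1,6]),
    ([0,6,7,2,1,5,4,3],[0,4,2,7,3,6,1,5]), ([4,5,6,7,2,0,3,1],[0,1,6,7,5,4,2,3]),
    ([2,6,7,0,3,4,5,1],[0,7,3,5,2,4,1,6]), ([0,6,7,2,1,5,4,3],[0,4,3,7,2,6,1,5]),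
    ([2,4,5,0,3,6,7,1],[0,6,2,5,3,4,1,7]), ([2,3,4,7,5,6,0,1],[0,2,3,1,6,5,4,7]),
    ([0,1,6,7,2,3,5,4],[0,2,1,3,4,7,5,6]), ([2,4,5,0,3,6,7,1],[0,6,3,5,2,4,1,7]),
    ([2,3,4,7,5,6,0,1],[0,3,2,1,6,5,4,7]), ([0,1,6,7,2,3,5,4],[0,3,1,2,4,7,5,6]),
    ([0,6,7,2,1,5,4,3],[0,5,2,7,3,6,1,4]), ([0,6,7,2,1,5,4,3],[0,5,3,7,2,6,1,4]),
    ([0,1,6,7,2,3,5,4],[0,2,1,3,5,7,4,6]), ([0,1,6,7,2,3,5,4],[0,3,1,2,5,7,4,6]),
    ([0,6,7,3,1,5,4,2],[0,7,2,5,3,4,1,6]), ([0,6,7,3,1,5,4,2],[0,7,3,5,2,4,1,6]),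
    ([4,7,5,6,2,3,1,0],[4,5,7,6,2,3,0,1]), ([0,1,6,4,3,2,7,5],[0,3,1,2,6,5,7,4]),
    ([0,1,5,4,2,3,7,6],[0,3,1,2,4,7,5,6]), ([4,7,5,6,2,3,1,0],[4,5,7,6,3,2,0,1]),
    ([0,1,6,4,3,2,7,5],[0,2,1,3,6,5,7,4]), ([0,1,5,4,2,3,7,6],[0,2,1,3,4,7,5,6]),
    ([0,1,4,6,3,2,5,7],[0,3,1,2,7,5,6,4]), ([4,7,5,6,0,1,3,2],[0,1,3,2,7,6,4,5]),
    ([0,1,4,6,5,7,3,2],[0,3,2,1,7,5,6,4]), ([0,1,4,6,3,2,5,7],[0,2,1,3,7,5,6,4]),
    ([4,7,5,6,0,1,3,2],[0,1,2,3,7,6,4,5]), ([0,1,4,6,5,7,3,2],[0,2,3,1,7,5,6,4]),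
    ([0,1,5,4,2,3,7,6],[0,3,1,2,5,7,4,6]), ([0,1,5,4,2,3,7,6],[0,2,1,3,5,7,4,6]),
    ([0,1,4,6,5,7,3,2],[0,3,2,1,7,4,6,5]), ([0,1,4,6,5,7,3,2],[0,2,3,1,7,4,6,5]),
    ([4,7,5,6,2,3,0,1],[0,1,2,3,6,7,5,4]), ([4,7,5,6,2,3,0,1],[0,1,3,2,6,7,5,4]),
    ([0,1,4,7,5,6,3,2],[0,3,2,1,7,5,4,6]), ([0,1,4,7,5,6,3,2],[0,2,3,1,7,5,4,6])]"
  by code_simp

lemma BH8_reps_completion_step_4:
  "completion_step 8 BH8_reps
   [[Z0,Z0,Z0,Z0,Z0,Z0,Z0,Z0], [Z0,Z0,Z0,Z0,Z2,Z2,Z2,Z2],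
    [Z0,Z1,Z2,Z3,Z0,Z1,Z2,Z3]] [
    ([0,1,6,7,4,3,2,5],[1,3,0,2,5,4,7,6]), ([0,1,6,7,3,4,2,5],[1,3,0,2,6,5,4,7]),
    ([0,1,5,7,3,6,4,2],[0,2,3,1,7,5,6,4]), ([0,6,7,1,3,4,5,2],[0,2,7,5,6,4,3,1]),
    ([2,5,0,7,1,4,3,6],[0,4,6,2,3,7,1,5]), ([0,1,6,5,7,4,3,2],[0,3,2,1,6,5,4,7]),
    ([0,1,3,5,2,7,4,6],[0,2,1,3,7,6,4,5]), ([0,1,4,3,5,2,7,6],[0,2,1,3,7,5,6,4]),
    ([0,1,2,6,4,5,3,7],[0,1,2,3,4,5,6,7]), ([0,1,5,3,4,7,2,6],[0,2,3,1,7,5,4,6]),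
    ([2,4,1,5,0,6,3,7],[0,6,4,2,3,5,1,7]), ([0,1,6,5,7,4,2,3],[0,2,3,1,5,7,6,4]),
    ([0,1,5,2,7,3,4,6],[0,1,2,3,4,7,5,6]), ([2,4,6,3,0,7,1,5],[0,2,4,6,7,5,3,1]),
    ([0,7,1,6,2,4,3,5],[0,2,4,6,1,3,5,7]), ([0,1,4,7,5,6,3,2],[0,2,3,1,7,6,5,4]),
    ([0,1,5,7,6,4,2,3],[0,2,3,1,4,7,6,5]), ([0,1,3,6,7,5,4,2],[0,3,2,1,6,7,5,4]),
    ([3,4,7,6,5,1,0,2],[0,1,7,4,5,6,2,3]), ([0,1,7,6,3,5,4,2],[0,2,3,1,6,4,7,5]),
    ([0,1,6,2,7,4,5,3],[0,1,2,3,6,7,4,5]), ([0,6,7,5,1,2,3,4],[0,6,1,7,3,5,2,4]),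
    ([0,1,7,5,6,2,3,4],[0,2,1,3,7,5,6,4]), ([0,7,1,5,4,6,2,3],[0,2,6,4,1,3,7,5])]"
  by code_simp

lemma BH8_reps_completion_step_5:
  "completion_step 8 BH8_reps
   [[Z0,Z0,Z0,Z0,Z0,Z0,Z0,Z0], [Z0,Z0,Z0,Z1,Z2,Z2,Z2,Z3],
    [Z0,Z0,Z2,Z2,Z0,Z1,Z3,Z2]] [
    ([0,2,1,5,6,3,4,7],[0,1,4,5,2,3,7,6]), ([0,1,2,5,6,3,4,7],[0,1,2,3,4,5,6,7]),
    ([0,7,1,6,2,5,4,3],[0,2,5,6,1,3,4,7]), ([0,7,2,5,1,6,4,3],[0,4,3,7,1,5,2,6]),
    ([0,7,2,5,1,6,3,4],[0,4,3,7,1,5,2,6]), ([0,7,1,6,2,5,3,4],[0,2,5,6,1,3,4,7])]"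
  by code_simp

lemma BH8_reps_completion_step_6:
  "completion_step 8 BH8_reps
   [[Z0,Z0,Z0,Z0,Z0,Z0,Z0,Z0], [Z0,Z0,Z0,Z1,Z2,Z2,Z2,Z3],
    [Z0,Z1,Z2,Z0,Z0,Z2,Z3,Z2]] [
    ([0,7,2,5,4,3,6,1],[0,4,7,5,3,1,6,2]), ([0,7,1,5,6,3,4,2],[0,2,6,5,1,3,7,4]),
    ([0,7,1,2,4,3,6,5],[0,1,5,6,2,3,4,7]), ([0,7,1,6,2,5,4,3],[0,2,4,5,1,3,6,7]),
    ([0,7,2,1,4,3,5,6],[0,3,5,7,4,1,2,6]), ([0,7,5,6,2,3,1,4],[0,5,4,2,3,7,1,6])]"
  by code_simp

lemma BH8_reps_completion_step_7:
  "completion_step 8 BH8_reps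
   [[Z0,Z0,Z0,Z0,Z0,Z0,Z0,Z0], [Z0,Z0,Z1,Z1,Z2,Z2,Z3,Z3],
    [Z0,Z0,Z2,Z3,Z1,Z3,Z1,Z2]] [
    ([0,6,5,2,4,7,1,3],[2,7,1,4,0,6,3,5]), ([0,5,7,2,4,6,1,3],[2,7,0,4,1,6,3,5]),
    ([0,7,3,4,6,2,5,1],[0,7,4,3,5,6,2,1]), ([0,7,4,3,5,1,6,2],[0,5,2,6,7,3,4,1]),
    ([0,7,3,4,1,6,5,2],[0,5,2,6,7,4,1,3]), ([0,7,4,3,2,5,6,1],[0,7,4,3,5,2,1,6])]"
  by code_simp

lemma BH8_reps_completion_step_8:
  "completion_step 8 BH8_reps
   [[Z0,Z0,Z0,Z0,Z0,Z0,Z0,Z0], [Z0,Z0,Z1,Z1,Z2,Z2,Z3,Z3],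
    [Z0,Z1,Z0,Z3,Z2,Z3,Z1,Z2]] [
    ([0,7,1,2,5,4,6,3],[0,1,4,5,2,3,6,7]), ([0,7,4,6,2,3,1,5],[0,4,6,3,2,7,1,5]),
    ([1,5,6,2,4,0,7,3],[0,5,6,2,3,7,4,1]), ([2,5,6,1,3,7,0,4],[0,7,6,5,3,1,4,2]),
    ([0,5,7,6,2,1,3,4],[0,4,2,7,1,5,6,3]), ([0,7,6,5,1,2,3,4],[0,4,1,5,3,6,7,2]),
    ([0,7,2,1,5,6,3,4],[0,2,4,7,1,6,3,5]), ([0,7,5,6,2,1,4,3],[0,4,2,7,6,3,5,1])]"
  by code_simp

lemma BH8_reps_cover: "covered_by 8 8 BH8_reps"
proof (rule covered_by_completion_step[OF BH8_3rows_cover])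
  show "\<exists>certs. completion_step 8 BH8_reps R certs" if "R \<in> set BH8_3rows" for R
    using that by (auto simp: BH8_3rows_def intro: 
        BH8_reps_completion_step_1 BH8_reps_completion_step_2 BH8_reps_completion_step_3
        BH8_reps_completion_step_4 BH8_reps_completion_step_5 BH8_reps_completion_step_6
        BH8_reps_completion_step_7 BH8_reps_completion_step_8)
qed simp_all

lemma BH8_reps_valid: "list_all (valid_matrix 8) BH8_reps"
  by code_simp

lemma BH8_reps_inequivalent: "distinct (map (invariant 8) BH8_reps)"
  by code_simp

section \<open>Order 1, where the zero row is already complete, and the theorem\<close>

lemma card_BH_classes_1: "card (BH_classes 4 1) = 1"
proof -
  have "covered_by 1 1 [[replicate 1 Z0]]"
    by (rule covered_by_zero_row) simp
  moreover have "list_all (valid_matrix 1) [[replicate 1 Z0]]"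
    by code_simp
  ultimately show ?thesis
    using card_BH_classes by fastforce
qed

theorem mainTheorem2:
  shows "card (BH_classes 4 1) = 1 \<and>
         card (BH_classes 4 2) = 1 \<and>
         card (BH_classes 4 4) = 2 \<and>
         card (BH_classes 4 6) = 1 \<and>
         card (BH_classes 4 8) = 15"
  using card_BH_classes_1
    card_BH_classes[OF BH2_reps_cover BH2_reps_valid BH2_reps_inequivalent]
    card_BH_classes[OF BH4_reps_cover BH4_reps_valid BH4_reps_inequivalent]
    card_BH_classes[OF BH6_reps_cover BH6_reps_valid BH6_reps_inequivalent]
    card_BH_classes[OF BH8_reps_cover BH8_reps_valid BH8_reps_inequivalent]
  by (simp add: BH2_reps_def BH4_reps_def BH6_reps_def BH8_reps_def)

end
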